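(* Let ${\bf d}={\bf d}(n)=(d_1,\ldots,d_n)$ be a degree sequence (for each $n$) satisfying $\Delta({\bf d})^2=o(\|{\bf d}\|_1)$ and $\delta({\bf d})\gg \log n$ as $n\to\infty$. Then there is a symmetric matrix $W\in[0,1]^{[n]\times[n]}$ with $W=(1-o(1))P({\bf d})$ (entrywise, with the $o(1)$ uniform over all entries) and a coupling $(G_L,G)$ with $G_L\sim\mathcal G(n,W)$ and $G\sim \mathcal G(n,{\bf d})$ such that $\mathbb P(G_L\subseteq G)=1-o(1)$.
   Context: A degree sequence ${\bf d}=(d_1,\dots,d_n)$ is a sequence of nonnegative integers that is the degree sequence of some simple graph on $[n]$; $\|{\bf d}\|_1=\sum_i d_i$, $\Delta({\bf d})=\max_i d_i$, $\delta({\bf d})=\min_i d_i$. $\mathcal G(n,{\bf d})$ denotes a uniformly random simple graph on $[n]$ in which vertex $i$ has degree $d_i$ for all $i$. For a symmetric matrix $W\in[0,1]^{[n]\times[n]}$, $\mathcal G(n,W)$ is the random graph on $[n]$ in which each edge $jk$ ($j\ne k$) is included independently with probability $W_{jk}$. $P({\bf d})$ is the symmetric $n\times n$ matrix with $P_{ij}=P_{ji}=\frac{d_id_j}{\|{\bf d}\|_1+d_id_j}$ for $i\ne j$ and $P_{ii}=0$. A coupling of two random graphs is a pair of random graphs defined on a common probability space with the given marginal distributions. Asymptotics are as $n\to\infty$; $a\gg b$ means $b/a\to 0$. *)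

theory Defs
  imports "HOL-Probability.Probability" "HOL-Probability.Product_PMF" "HOL-Library.Landau_Symbols"
begin

text \<open>
  A simple graph on the vertex set \<open>{1..n}\<close> is identified with its edge set, a subset of
  \<open>all_edges n\<close>. Degree sequences and matrices are total functions of which only the values
  at indices in \<open>{1..n}\<close> matter.
\<close>

type_synonym edge_set = "nat set set"

definition all_edges :: "nat \<Rightarrow> edge_set" where
  "all_edges n = {{j, k} | j k. j \<in> {1..n} \<and> k \<in> {1..n} \<and> j \<noteq> k}"

definition vertex_degree :: "edge_set \<Rightarrow> nat \<Rightarrow> nat" where
  "vertex_degree E i = card {e \<in> E. i \<in> e}"

definition graphs_with_degrees :: "nat \<Rightarrow> (nat \<Rightarrow> nat) \<Rightarrow> edge_set set" where
  "graphs_with_degrees n d = {E. E \<subseteq> all_edges n \<and> (\<forall>i\<in>{1..n}. vertex_degree E i = d i)}"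

definition degree_sequence :: "nat \<Rightarrow> (nat \<Rightarrow> nat) \<Rightarrow> bool" where
  "degree_sequence n d \<longleftrightarrow> graphs_with_degrees n d \<noteq> {}"

definition degree_sum :: "nat \<Rightarrow> (nat \<Rightarrow> nat) \<Rightarrow> nat" where
  "degree_sum n d = (\<Sum>i\<in>{1..n}. d i)"

text \<open>The next two are only meaningful for \<open>n \<ge> 1\<close>; they are used only asymptotically.\<close>

definition max_degree :: "nat \<Rightarrow> (nat \<Rightarrow> nat) \<Rightarrow> nat" where
  "max_degree n d = Max (d ` {1..n})"

definition min_degree :: "nat \<Rightarrow> (nat \<Rightarrow> nat) \<Rightarrow> nat" where
  "min_degree n d = Min (d ` {1..n})"

lemma finite_all_edges: "finite (all_edges n)"
  by (rule finite_subset[of _ "Pow {1..n}"]) (auto simp: all_edges_def)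

lemma finite_graphs_with_degrees: "finite (graphs_with_degrees n d)"
  by (rule finite_subset[of _ "Pow (all_edges n)"])
     (auto simp: graphs_with_degrees_def finite_all_edges)

text \<open>
  The uniform random graph with degrees \<open>d\<close>. Since \<^const>\<open>pmf_of_set\<close> is unspecified on the
  empty set, this is meaningful only if \<open>degree_sequence n d\<close>.
\<close>

definition random_graph_degrees :: "nat \<Rightarrow> (nat \<Rightarrow> nat) \<Rightarrow> edge_set pmf" where
  "random_graph_degrees n d = pmf_of_set (graphs_with_degrees n d)"

text \<open>
  The random graph with independent edges, \<open>{j, k}\<close> being present with probability \<open>W j k\<close>.
  The matrix is read off above the diagonal, which is all of it when \<open>W\<close> is symmetric;
  entries are assumed to lie in \<open>[0, 1]\<close>, outside of which \<^const>\<open>bernoulli_pmf\<close> truncates.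
\<close>

definition random_graph_matrix :: "nat \<Rightarrow> (nat \<Rightarrow> nat \<Rightarrow> real) \<Rightarrow> edge_set pmf" where
  "random_graph_matrix n W =
     map_pmf (\<lambda>b. {e \<in> all_edges n. b e})
       (Pi_pmf (all_edges n) False (\<lambda>e. bernoulli_pmf (W (Min e) (Max e))))"

definition degree_matrix :: "nat \<Rightarrow> (nat \<Rightarrow> nat) \<Rightarrow> nat \<Rightarrow> nat \<Rightarrow> real" where
  "degree_matrix n d i j =
     (if i = j then 0
      else real (d i * d j) / real (degree_sum n d + d i * d j))"

definition coupling ::
    "'w measure \<Rightarrow> ('w \<Rightarrow> 'a) \<Rightarrow> ('w \<Rightarrow> 'b) \<Rightarrow> 'a pmf \<Rightarrow> 'b pmf \<Rightarrow> bool" where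
  "coupling M X Y p q \<longleftrightarrow>
     prob_space M \<and>
     X \<in> measurable M (count_space UNIV) \<and> distr M (count_space UNIV) X = measure_pmf p \<and>
     Y \<in> measurable M (count_space UNIV) \<and> distr M (count_space UNIV) Y = measure_pmf q"

end

theory Submission imports Defs begin

text \<open>
  Choose \<open>G\<close> uniformly and expose its \<open>m\<close> edges in uniformly random order. Given the set \<open>H\<close> of the
  first \<open>t\<close> of them, \<open>G\<close> is uniform among the graphs with degrees \<open>d\<close> containing \<open>H\<close>, so the next edge is
  \<open>jk\<close> with probability \<open>P(jk \<in> G | H \<subseteq> G) / (m - t)\<close>. A switching argument bounds this from below in
  terms of the residual degrees, and as long as a fixed positive fraction of the edges is still
  unexposed those degrees are concentrated, so that with high probability the bound is
  \<open>(1 - o(1)) d\<^sub>j d\<^sub>k / (2 m\<^sup>2)\<close>. Hence independent draws of single edges with these probabilities can be coupled into the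
  exposed set step by step, and taking a Poisson number of draws makes the edges independent.
\<close>

section \<open>Approximate stochastic domination\<close>

text \<open>All losses are governed by one number \<alpha>, fixed while n grows. Concentration and
  switching need at least \<alpha> m unexposed edges, so at most (1 - \<alpha>) m draws can be
  coupled; the Poisson mean is (1 - 2\<alpha>) m, which leaves room below that cap. The edge
  probability bound loses a factor 1 - 4\<alpha>, so a draw has total weight at most 1 - 4\<alpha>
  and is empty otherwise. A fixed number of draws would leave the edges dependent; the price of a
  random number is that jk gets probability 1 - exp(-c x), with x = d_j d_k / ||d||_1 and c = (1 -
  2\<alpha>)(1 - 4\<alpha>), and not a multiple of the entry x / (1 + x) of P(d). The condition on
  the maximum degree acts twice: few switchings are spoiled, and x is uniformly small, so the two
  formulas agree up to a factor 1 - O(\<alpha>). The condition on the minimum degree pays for a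
  union bound over all exposure times and vertices: at most n^3 events, each of probability
  exponentially small in the minimum degree at a rate depending on \<alpha>. A diagonal argument
  finally lets \<alpha> tend to 0.\<close>

lemma measure_bind_pmf:
  "measure (bind_pmf p f) X = (\<integral>x. measure (f x) X \<partial>measure_pmf p)"
proof -
  have "ennreal (measure (bind_pmf p f) X) = (\<integral>\<^sup>+x. ennreal (measure (f x) X) \<partial>p)"
    by (simp flip: measure_pmf.emeasure_eq_measure)
  also have "\<dots> = ennreal (\<integral>x. measure (f x) X \<partial>p)"
    by (rule nn_integral_eq_integral)
      (auto intro!: measure_pmf.integrable_const_bound[where B = 1])
  finally show ?thesis
    by (simp add: integral_nonneg)
qed

text \<open>
  First draw \<open>H'\<close> from \<open>K\<close>, then let \<open>Y\<close> be the new point with the conditional probability that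
  makes its marginal right; otherwise draw \<open>Y\<close> from \<open>\<kappa>\<close> conditioned on \<open>Y \<subseteq> H\<close>.
\<close>
lemma one_point_coupling:
  fixes \<kappa> K :: "'a set pmf"
  assumes fin: "finite (set_pmf K)"
    and Y: "\<And>Y. Y \<in> set_pmf \<kappa> \<Longrightarrow> Y = {} \<or> (\<exists>e. Y = {e})" and emp: "{} \<in> set_pmf \<kappa>"
    and H': "\<And>H'. H' \<in> set_pmf K \<Longrightarrow> \<exists>e. e \<notin> H \<and> H' = insert e H"
    and le: "\<And>e. e \<notin> H \<Longrightarrow> pmf \<kappa> {e} \<le> pmf K (insert e H)"
  shows "\<exists>C. map_pmf fst C = \<kappa> \<and> map_pmf snd C = K \<and> (\<forall>(Y, H') \<in> set_pmf C. Y \<union> H \<subseteq> H')"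
proof -
  define r where "r = (\<lambda>H'. pmf \<kappa> (H' - H) / pmf K H')"
  define \<rho> where "\<rho> = cond_pmf \<kappa> {Y. Y \<subseteq> H}"
  define C where "C = bind_pmf K (\<lambda>H'. bind_pmf (bernoulli_pmf (r H'))
     (\<lambda>b. map_pmf (\<lambda>Y. (Y, H')) (if b then return_pmf (H' - H) else \<rho>)))"
  \<comment> \<open>The empty set lies below every \<open>H\<close>, so \<open>emp\<close> gives the
    event that defines \<open>\<rho>\<close> positive probability.\<close>
  have ne: "set_pmf \<kappa> \<inter> {Y. Y \<subseteq> H} \<noteq> {}" using emp by auto
  have r: "0 \<le> r H'" "r H' \<le> 1" "pmf K H' * r H' = pmf \<kappa> (H' - H)" if K: "H' \<in> set_pmf K" for H'
  proof -
    obtain e where "e \<notin> H" "H' = insert e H" using H' K by blast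
    then have "H' - H = {e}" "pmf \<kappa> {e} \<le> pmf K H'" using le by auto
    moreover have "pmf K H' > 0" using that by (simp add: pmf_positive)
    ultimately show "0 \<le> r H'" "r H' \<le> 1" "pmf K H' * r H' = pmf \<kappa> (H' - H)"
      by (auto simp: r_def)
  qed
  have snd: "map_pmf snd C = K"
    by (simp add: C_def map_bind_pmf map_pmf_comp bind_return_pmf' if_distrib cong: if_cong)
  have inj: "inj_on (\<lambda>H'. H' - H) (set_pmf K)"
    by (rule inj_onI) (use H' in blast)
  have pmf1: "pmf (map_pmf fst C) Y =
      (\<Sum>H'\<in>set_pmf K. if H' - H = Y then pmf \<kappa> Y else 0) +
      pmf \<rho> Y * (\<Sum>H'\<in>set_pmf K. pmf K H' * (1 - r H'))" for Y
  proof -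
    have "pmf (map_pmf fst C) Y = (\<Sum>H'\<in>set_pmf K. pmf K H' * pmf (bind_pmf (bernoulli_pmf (r H'))
         (\<lambda>b. (if b then return_pmf (H' - H) else \<rho>))) Y)"
      unfolding C_def map_bind_pmf map_pmf_comp
      by (subst pmf_bind, subst integral_measure_pmf[OF fin]) auto
    also have "\<dots> = (\<Sum>H'\<in>set_pmf K. (if H' - H = Y then pmf \<kappa> Y else 0) +
        pmf \<rho> Y * (pmf K H' * (1 - r H')))"
    proof (rule sum.cong)
      fix x assume x: "x \<in> set_pmf K"
      show "pmf K x * pmf (bind_pmf (bernoulli_pmf (r x))
         (\<lambda>b. if b then return_pmf (x - H) else \<rho>)) Y =
          (if x - H = Y then pmf \<kappa> Y else 0) + pmf \<rho> Y * (pmf K x * (1 - r x))"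
        using r[OF x] by (auto simp: pmf_bind algebra_simps)
    qed simp
    finally show ?thesis by (simp add: sum.distrib sum_distrib_left)
  qed
  have notin: "pmf \<kappa> Y = pmf (map_pmf fst C) Y" if sub: "\<not> Y \<subseteq> H" for Y
  proof (cases "Y \<in> (\<lambda>H'. H' - H) ` set_pmf K")
    case True
    then obtain H0 where H0: "H0 \<in> set_pmf K" "Y = H0 - H" by auto
    have "(\<Sum>H'\<in>set_pmf K. if H' - H = Y then pmf \<kappa> Y else 0) =
       (\<Sum>H'\<in>set_pmf K. if H' = H0 then pmf \<kappa> Y else 0)"
      using H0 inj by (intro sum.cong) (auto simp: inj_on_def)
    also have "\<dots> = pmf \<kappa> Y" using fin H0 by simp
    finally show ?thesis using that by (simp add: pmf1 \<rho>_def pmf_cond[OF ne])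
  next
    case False
    \<comment> \<open>If \<open>\<kappa>\<close> charged \<open>{e}\<close> with \<open>e\<close>
      outside \<open>H\<close>, then by \<open>le\<close> also \<open>K\<close> would charge
      \<open>insert e H\<close>, and \<open>{e}\<close> would be one of the differences
      \<open>H' - H\<close>.\<close>
    have "pmf \<kappa> Y = 0"
    proof (rule ccontr)
      assume "pmf \<kappa> Y \<noteq> 0"
      then have "Y \<in> set_pmf \<kappa>" by (simp add: set_pmf_iff)
      then obtain e where e: "Y = {e}" "e \<notin> H" using Y sub by blast
      then have "pmf K (insert e H) > 0" using le[of e] \<open>pmf \<kappa> Y \<noteq> 0\<close>
        by (metis pmf_nonneg order_less_le order_le_less_trans)
      then have "insert e H \<in> set_pmf K" by (simp add: set_pmf_iff)
      then show False using False e by (auto simp: image_iff)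
    qed
    moreover have "(\<Sum>H'\<in>set_pmf K. if H' - H = Y then pmf \<kappa> Y else 0) = 0"
      using False by (intro sum.neutral) auto
    ultimately show ?thesis using that by (simp add: pmf1 \<rho>_def pmf_cond[OF ne])
  qed
  have fst: "map_pmf fst C = \<kappa>"
  proof -
    have sub: "pmf (map_pmf fst C) Y = pmf \<kappa> Y * ((\<Sum>H'\<in>set_pmf K. pmf K H' * (1 - r H')) / measure \<kappa> {Y. Y \<subseteq> H})"
      if "Y \<subseteq> H" for Y
    proof -
      have "(\<Sum>H'\<in>set_pmf K. if H' - H = Y then pmf \<kappa> Y else 0) = 0"
        using H' that by (intro sum.neutral) fastforce
      then show ?thesis using that by (simp add: pmf1 \<rho>_def pmf_cond[OF ne])
    qed
    \<comment> \<open>The branch that returns the new point spends exactly the mass that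
      \<open>\<kappa>\<close> gives to sets not inside \<open>H\<close>; what remains is the
      normalising constant of \<open>\<rho>\<close>.\<close>
    have "(\<Sum>H'\<in>set_pmf K. pmf K H' * (1 - r H')) = measure \<kappa> {Y. Y \<subseteq> H}"
    proof -
      have "(\<Sum>H'\<in>set_pmf K. pmf K H' * (1 - r H')) =
          (\<Sum>H'\<in>set_pmf K. pmf K H' - pmf \<kappa> (H' - H))"
        by (intro sum.cong) (auto simp: right_diff_distrib r)
      also have "\<dots> = 1 - (\<Sum>H'\<in>set_pmf K. pmf \<kappa> (H' - H))"
        using sum_pmf_eq_1[OF fin, of K] by (simp add: sum_subtractf)
      also have "(\<Sum>H'\<in>set_pmf K. pmf \<kappa> (H' - H)) = sum (pmf \<kappa>) ((\<lambda>H'. H' - H) ` set_pmf K)"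
        using inj by (simp add: sum.reindex)
      also have "\<dots> = measure \<kappa> ((\<lambda>H'. H' - H) ` set_pmf K)"
        using fin by (simp add: measure_measure_pmf_finite)
      also have "\<dots> = measure \<kappa> {Y. \<not> Y \<subseteq> H}"
      proof (rule measure_prob_cong_0)
        fix Y assume "Y \<in> (\<lambda>H'. H' - H) ` set_pmf K - {Y. \<not> Y \<subseteq> H}"
        then show "pmf \<kappa> Y = 0" using H' by fastforce
      next
        fix Y assume Y': "Y \<in> {Y. \<not> Y \<subseteq> H} - (\<lambda>H'. H' - H) ` set_pmf K"
        then have "(\<Sum>H'\<in>set_pmf K. if H' - H = Y then pmf \<kappa> Y else 0) = 0"
          by (intro sum.neutral) auto
        then show "pmf \<kappa> Y = 0"
          using Y' notin[of Y] by (simp add: pmf1 \<rho>_def pmf_cond[OF ne])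
      qed
      also have "1 - \<dots> = measure \<kappa> {Y. Y \<subseteq> H}"
      proof -
        have eq: "{Y. Y \<subseteq> H} = space (measure_pmf \<kappa>) - {Y. \<not> Y \<subseteq> H}" by auto
        show ?thesis unfolding eq by (subst measure_pmf.prob_compl) auto
      qed
      finally show ?thesis .
    qed
    moreover have "measure \<kappa> {Y. Y \<subseteq> H} \<noteq> 0"
      using ne by (simp add: measure_measure_pmf_not_zero)
    ultimately show ?thesis
      using notin by (intro pmf_eqI) (case_tac "i \<subseteq> H"; simp add: sub)
  qed
  have "\<forall>(Y, H') \<in> set_pmf C. Y \<union> H \<subseteq> H'"
  proof safe
    fix Y H' x assume "(Y, H') \<in> set_pmf C"
    then have 1: "H' \<in> set_pmf K" and "Y = H' - H \<or> Y \<in> set_pmf \<rho>"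
      by (auto simp: C_def split: if_splits)
    then have "Y = H' - H \<or> Y \<subseteq> H" using ne by (auto simp: \<rho>_def set_cond_pmf)
    moreover have "H \<subseteq> H'" using H'[OF 1] by auto
    ultimately show "x \<in> H'" if "x \<in> Y" using that by auto
    show "x \<in> H'" if "x \<in> H" using \<open>H \<subseteq> H'\<close> that by auto
  qed
  with fst snd show ?thesis by blast
qed

text \<open>With \<open>\<beta> = 0\<close> this is stochastic domination for inclusion, in its
  coupling form; \<open>\<beta>\<close> is the failure probability that accumulates over the
  exposure steps.\<close>

definition approx_dominated :: "'a set pmf \<Rightarrow> 'a set pmf \<Rightarrow> real \<Rightarrow> bool" where
  "approx_dominated p q \<beta> \<longleftrightarrow>
    (\<exists>\<pi>. map_pmf fst \<pi> = p \<and> map_pmf snd \<pi> = q \<and> measure \<pi> {(L, H). \<not> L \<subseteq> H} \<le> \<beta>)"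

lemma approx_dominated_trivial: "approx_dominated p q 1"
  unfolding approx_dominated_def
  by (intro exI[of _ "pair_pmf p q"]) (simp add: map_fst_pair_pmf map_snd_pair_pmf)

text \<open>The law \<open>\<kappa>\<close> of the added draw is the same for every
  \<open>H\<close>, so the draw is independent of the pair built so far and its union with
  \<open>L\<close> has the required law. Containment can only be lost if it was lost before or if
  \<open>H\<close> is in \<open>B\<close>.\<close>

lemma approx_dominated_bind_Un:
  assumes pq: "approx_dominated p q \<beta>"
    and K: "\<And>H. H \<in> set_pmf q \<Longrightarrow> H \<notin> B \<Longrightarrow>
      \<exists>C. map_pmf fst C = \<kappa> \<and> map_pmf snd C = K H \<and> (\<forall>(Y, H') \<in> set_pmf C. Y \<union> H \<subseteq> H')"
  shows "approx_dominated (bind_pmf p (\<lambda>L. map_pmf (\<lambda>Y. L \<union> Y) \<kappa>)) (bind_pmf q K)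
    (\<beta> + measure q B)"
proof -
  from pq obtain \<pi> where \<pi>: "map_pmf fst \<pi> = p" "map_pmf snd \<pi> = q"
    "measure \<pi> {(L, H). \<not> L \<subseteq> H} \<le> \<beta>" unfolding approx_dominated_def by blast
  \<comment> \<open>Away from the good sets any coupling will do; the product coupling supplies
    one.\<close>
  have "\<exists>C. map_pmf fst C = \<kappa> \<and> map_pmf snd C = K H \<and>
      (H \<in> set_pmf q - B \<longrightarrow> (\<forall>(Y, H') \<in> set_pmf C. Y \<union> H \<subseteq> H'))" for H
    by (cases "H \<in> set_pmf q - B")
      (use K[of H] in \<open>auto intro!: exI[of _ "pair_pmf \<kappa> (K H)"] simp: map_fst_pair_pmf map_snd_pair_pmf\<close>)
  then obtain C where C: "\<And>H. map_pmf fst (C H) = \<kappa>" "\<And>H. map_pmf snd (C H) = K H"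
    "\<And>H Y H'. H \<in> set_pmf q \<Longrightarrow> H \<notin> B \<Longrightarrow> (Y, H') \<in> set_pmf (C H) \<Longrightarrow> Y \<union> H \<subseteq> H'"
    by (metis (no_types, lifting) Diff_iff case_prodD)
  define \<pi>' where "\<pi>' = bind_pmf \<pi> (\<lambda>(L, H). map_pmf (\<lambda>(Y, H'). (L \<union> Y, H')) (C H))"
  have "map_pmf fst \<pi>' = bind_pmf \<pi> (\<lambda>(L, H). map_pmf (\<lambda>Y. L \<union> Y) (map_pmf fst (C H)))"
    by (simp add: \<pi>'_def map_bind_pmf map_pmf_comp case_prod_unfold)
  also have "\<dots> = bind_pmf p (\<lambda>L. map_pmf (\<lambda>Y. L \<union> Y) \<kappa>)"
    unfolding C \<pi>(1)[symmetric] by (simp add: bind_map_pmf case_prod_unfold)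
  finally have 1: "map_pmf fst \<pi>' = bind_pmf p (\<lambda>L. map_pmf (\<lambda>Y. L \<union> Y) \<kappa>)" .
  have "map_pmf snd \<pi>' = bind_pmf \<pi> (\<lambda>(L, H). map_pmf snd (C H))"
    by (simp add: \<pi>'_def map_bind_pmf map_pmf_comp case_prod_unfold)
  also have "\<dots> = bind_pmf q K"
    unfolding C \<pi>(2)[symmetric] by (simp add: bind_map_pmf case_prod_unfold)
  finally have 2: "map_pmf snd \<pi>' = bind_pmf q K" .
  let ?N = "{(L, H). \<not> L \<subseteq> H}"
  have "measure \<pi>' ?N = (\<integral>z. measure (case z of (L, H) \<Rightarrow> map_pmf (\<lambda>(Y, H'). (L \<union> Y, H')) (C H)) ?N \<partial>\<pi>)"
    unfolding \<pi>'_def measure_bind_pmf ..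
  also have "\<dots> \<le> (\<integral>z. indicator (?N \<union> snd -` B) z \<partial>\<pi>)"
  proof (rule integral_mono_AE)
    show "AE z in \<pi>. measure (case z of (L, H) \<Rightarrow> map_pmf (\<lambda>(Y, H'). (L \<union> Y, H')) (C H)) ?N
      \<le> indicator (?N \<union> snd -` B) z"
      unfolding AE_measure_pmf_iff
    proof safe
      fix L H assume LH: "(L, H) \<in> set_pmf \<pi>"
      show "measure (map_pmf (\<lambda>(Y, H'). (L \<union> Y, H')) (C H)) ?N \<le> indicator (?N \<union> snd -` B) (L, H)"
      proof (cases "(L, H) \<in> ?N \<union> snd -` B")
        case False
        have "H \<in> set_pmf q" using LH \<pi>(2) by force
        then have "set_pmf (map_pmf (\<lambda>(Y, H'). (L \<union> Y, H')) (C H)) \<inter> ?N = {}"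
          using C(3)[of H] False by fastforce
        then have "measure (map_pmf (\<lambda>(Y, H'). (L \<union> Y, H')) (C H)) ?N = 0"
          by (simp only: measure_pmf_zero_iff)
        then show ?thesis by simp
      qed simp
    qed
  qed (auto intro!: measure_pmf.integrable_const_bound[where B = 1])
  also have "\<dots> = measure \<pi> (?N \<union> snd -` B)" by simp
  also have "\<dots> \<le> measure \<pi> ?N + measure \<pi> (snd -` B)"
    by (rule measure_Un_le) auto
  also have "measure \<pi> (snd -` B) = measure q B"
    unfolding \<pi>(2)[symmetric] by simp
  finally show ?thesis using 1 2 \<pi>(3) unfolding approx_dominated_def
    by (intro exI[of _ \<pi>']) auto
qed

text \<open>Enlarging the upper set is a step whose draw is always empty and whose bad set is
  empty.\<close>

lemma approx_dominated_supersets: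
  assumes pq: "approx_dominated p q \<beta>"
    and K: "\<And>H G. H \<in> set_pmf q \<Longrightarrow> G \<in> set_pmf (K H) \<Longrightarrow> H \<subseteq> G"
  shows "approx_dominated p (bind_pmf q K) \<beta>"
proof -
  have "approx_dominated (bind_pmf p (\<lambda>L. map_pmf (\<lambda>Y. L \<union> Y) (return_pmf {}))) (bind_pmf q K)
    (\<beta> + measure q {})"
    using K by (intro approx_dominated_bind_Un[OF pq] exI[of _ "map_pmf (\<lambda>G. ({}, G)) (K _)"])
      (auto simp: map_pmf_comp)
  then show ?thesis by (simp add: bind_return_pmf')
qed

lemma approx_dominated_mono: "approx_dominated p q \<beta> \<Longrightarrow> \<beta> \<le> \<beta>' \<Longrightarrow> approx_dominated p q \<beta>'"
  unfolding approx_dominated_def by (metis order_trans)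

text \<open>All the couplings share the second marginal \<open>q\<close>, so choosing among them at
  random does not disturb it; an index outside \<open>I\<close> is charged failure probability 1.
  This lets the number of draws be random.\<close>

lemma approx_dominated_mixture:
  assumes "0 \<le> \<beta>" and p: "\<And>i. i \<in> I \<Longrightarrow> approx_dominated (p i) q \<beta>"
  shows "approx_dominated (bind_pmf N p) q (\<beta> + measure N (- I))"
proof -
  have "approx_dominated (p i) q (if i \<in> I then \<beta> else 1)" for i
    using p[of i] approx_dominated_trivial by auto
  then obtain \<pi> where \<pi>: "\<And>i. map_pmf fst (\<pi> i) = p i" "\<And>i. map_pmf snd (\<pi> i) = q"
    "\<And>i. measure (\<pi> i) {(L, H). \<not> L \<subseteq> H} \<le> (if i \<in> I then \<beta> else 1)"
    unfolding approx_dominated_def by metis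
  have "measure (bind_pmf N \<pi>) {(L, H). \<not> L \<subseteq> H} \<le> (\<integral>i. \<beta> + indicator (-I) i \<partial>N)"
    unfolding measure_bind_pmf
  proof (rule integral_mono)
    show "measure (\<pi> i) {(L, H). \<not> L \<subseteq> H} \<le> \<beta> + indicator (-I) i" for i
      using \<pi>(3)[of i] \<open>0 \<le> \<beta>\<close> by (cases "i \<in> I") (auto intro: add_increasing)
    show "integrable N (\<lambda>i. \<beta> + indicator (- I) i)"
      using \<open>0 \<le> \<beta>\<close> by (intro measure_pmf.integrable_const_bound[where B = "\<beta> + 1"])
        (auto split: split_indicator)
  qed (auto intro!: measure_pmf.integrable_const_bound[where B = 1])
  also have "\<dots> = \<beta> + measure N (- I)"
    by (subst Bochner_Integration.integral_add) (auto intro!: measure_pmf.integrable_const_bound[where B = 1])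
  finally show ?thesis unfolding approx_dominated_def
    by (intro exI[of _ "bind_pmf N \<pi>"]) (auto simp: map_bind_pmf \<pi> bind_return_pmf')
qed

section \<open>Exposing a random member of a uniform family\<close>

text \<open>Only the set of the first \<open>t\<close> elements of a uniform ordering of
  \<open>G\<close> matters, never their order, and that set is a uniform
  \<open>t\<close>-subset.\<close>

definition random_subset :: "nat \<Rightarrow> 'a set \<Rightarrow> 'a set pmf" where
  "random_subset t G = pmf_of_set {H. H \<subseteq> G \<and> card H = t}"

section \<open>Double counting for uniform distributions\<close>

lemma cond_pmf_of_set:
  assumes "finite S" "S \<inter> A \<noteq> {}"
  shows "cond_pmf (pmf_of_set S) A = pmf_of_set (S \<inter> A)"
proof (rule pmf_eqI)
  fix x
  have S0: "S \<noteq> {}" using assms by auto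
  then have S: "set_pmf (pmf_of_set S) \<inter> A \<noteq> {}" "card S > 0"
    using assms by (simp_all add: card_gt_0_iff)
  show "pmf (cond_pmf (pmf_of_set S) A) x = pmf (pmf_of_set (S \<inter> A)) x"
    using assms S S0 by (auto simp: pmf_cond[OF S(1)] measure_pmf_of_set indicator_def)
qed

text \<open>Constant fibre size makes the product of the two uniform probabilities the same for all
  pairs in \<open>S\<close>. Applied to an incidence relation from both sides, this exchanges the
  order in which two related objects are sampled.\<close>

lemma bind_pmf_of_set_fibres:
  assumes S: "finite S" "S \<noteq> {}" and c: "\<And>x. x \<in> fst ` S \<Longrightarrow> card {y. (x, y) \<in> S} = c"
  shows "bind_pmf (pmf_of_set (fst ` S)) (\<lambda>x. map_pmf (Pair x) (pmf_of_set {y. (x, y) \<in> S})) = pmf_of_set S"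
proof (rule pmf_eqI)
  fix z :: "'a \<times> 'b"
  obtain a b where z: "z = (a, b)" by fastforce
  have finy: "finite {y. (x, y) \<in> S}" for x
    by (rule finite_subset[of _ "snd ` S"]) (use S in force)+
  have card: "card S = card (fst ` S) * c"
  proof -
    have "Sigma (fst ` S) (\<lambda>x. {y. (x, y) \<in> S}) = S" by force
    then have "card S = card (Sigma (fst ` S) (\<lambda>x. {y. (x, y) \<in> S}))" by simp
    also have "\<dots> = (\<Sum>x\<in>fst ` S. card {y. (x, y) \<in> S})"
      using S finy by (intro card_SigmaI) auto
    finally show ?thesis using c by simp
  qed
  have "pmf (map_pmf (Pair x) (pmf_of_set {y. (x, y) \<in> S})) z = (if x = a then indicator S z / c else 0)"
    if x: "x \<in> fst ` S" for x
  proof -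
    have ne: "{y. (x, y) \<in> S} \<noteq> {}" using x by auto
    have "Pair x -` {z} = (if x = a then {b} else {})" by (auto simp: z)
    then show ?thesis
      using pmf_of_set[OF ne finy[of x]] c[OF x]
      by (cases "x = a") (simp_all add: pmf_map measure_pmf_single z indicator_def)
  qed
  then have "pmf (bind_pmf (pmf_of_set (fst ` S)) (\<lambda>x. map_pmf (Pair x) (pmf_of_set {y. (x, y) \<in> S}))) z
      = (\<Sum>x\<in>fst ` S. if x = a then indicator S z / c else 0) / card (fst ` S)"
    using S by (simp add: pmf_bind_pmf_of_set cong: sum.cong)
  also have "\<dots> = indicator S z / card S"
    using S by (auto simp: card z indicator_def image_iff)
  finally show "pmf (bind_pmf (pmf_of_set (fst ` S)) (\<lambda>x. map_pmf (Pair x) (pmf_of_set {y. (x, y) \<in> S}))) z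
      = pmf (pmf_of_set S) z"
    using S by simp
qed

lemma bind_pmf_of_set_swap_fibres:
  assumes S: "finite S" "S \<noteq> {}" and c: "\<And>y. y \<in> snd ` S \<Longrightarrow> card {x. (x, y) \<in> S} = c"
  shows "bind_pmf (pmf_of_set (snd ` S)) (\<lambda>y. map_pmf (\<lambda>x. (x, y)) (pmf_of_set {x. (x, y) \<in> S})) = pmf_of_set S"
proof -
  have sw: "fst ` prod.swap ` S = snd ` S" "\<And>y. {x. (y, x) \<in> prod.swap ` S} = {x. (x, y) \<in> S}"
    by (auto simp: image_image) 
  have "bind_pmf (pmf_of_set (snd ` S)) (\<lambda>y. map_pmf (Pair y) (pmf_of_set {x. (x, y) \<in> S}))
      = pmf_of_set (prod.swap ` S)"
    using bind_pmf_of_set_fibres[of "prod.swap ` S" c] S c unfolding sw by simp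
  then have "map_pmf prod.swap (bind_pmf (pmf_of_set (snd ` S)) (\<lambda>y. map_pmf (Pair y) (pmf_of_set {x. (x, y) \<in> S})))
      = map_pmf prod.swap (map_pmf prod.swap (pmf_of_set S))"
    using S by (subst map_pmf_of_set_inj) auto
  then show ?thesis by (simp add: map_bind_pmf map_pmf_comp)
qed

lemma card_subsets_containing:
  assumes "finite G" "A \<subseteq> G" "card A \<le> t"
  shows "card {H. A \<subseteq> H \<and> H \<subseteq> G \<and> card H = t} = (card G - card A) choose (t - card A)"
proof -
  have fA: "finite A" using assms finite_subset by blast
  have "bij_betw (\<lambda>H. H - A) {H. A \<subseteq> H \<and> H \<subseteq> G \<and> card H = t} {B. B \<subseteq> G - A \<and> card B = t - card A}"
  proof (rule bij_betw_byWitness[where f' = "\<lambda>B. B \<union> A"])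
    show "(\<lambda>H. H - A) ` {H. A \<subseteq> H \<and> H \<subseteq> G \<and> card H = t} \<subseteq> {B. B \<subseteq> G - A \<and> card B = t - card A}"
      using fA by (auto simp: card_Diff_subset)
    show "(\<lambda>B. B \<union> A) ` {B. B \<subseteq> G - A \<and> card B = t - card A} \<subseteq> {H. A \<subseteq> H \<and> H \<subseteq> G \<and> card H = t}"
    proof safe
      fix B assume B: "B \<subseteq> G - A" "card B = t - card A"
      then have "finite B" using assms finite_subset by blast
      then have "card (B \<union> A) = card B + card A" using fA B by (intro card_Un_disjoint) auto
      then show "card (B \<union> A) = t" using B assms by simp
    qed (use assms in auto)
  qed auto
  then have "card {H. A \<subseteq> H \<and> H \<subseteq> G \<and> card H = t} = card {B. B \<subseteq> G - A \<and> card B = t - card A}"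
    by (rule bij_betw_same_card)
  also have "\<dots> = card (G - A) choose (t - card A)"
    using assms by (intro n_subsets) auto
  finally show ?thesis using assms fA by (simp add: card_Diff_subset)
qed

text \<open>Both laws are that of the larger member of a uniform nested pair of subsets of
  \<open>G\<close> with sizes \<open>t\<close> and \<open>t + 1\<close>: each small set has
  \<open>card G - t\<close> extensions and each large set \<open>t + 1\<close> restrictions, so
  either member may be sampled before the other.\<close>

lemma random_subset_Suc:
  assumes G: "finite G" and t: "t < card G"
  shows "bind_pmf (random_subset t G) (\<lambda>H. map_pmf (\<lambda>e. insert e H) (pmf_of_set (G - H))) = random_subset (Suc t) G"
proof -
  define S where "S = {(H, H'). H \<subseteq> H' \<and> H' \<subseteq> G \<and> card H = t \<and> card H' = Suc t}"
  have fin: "finite H" if "H \<subseteq> G" for H using that G finite_subset by blast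
  have "finite S"
    by (rule finite_subset[of _ "Pow G \<times> Pow G"]) (use G in \<open>auto simp: S_def\<close>)
  have ins: "{H'. (H, H') \<in> S} = (\<lambda>e. insert e H) ` (G - H)" if "H \<subseteq> G" "card H = t" for H
  proof (intro equalityI subsetI)
    fix H' assume "H' \<in> {H'. (H, H') \<in> S}"
    then have H': "H \<subseteq> H'" "H' \<subseteq> G" "card H' = Suc t" by (auto simp: S_def)
    then have "card (H' - H) = 1" using that fin by (simp add: card_Diff_subset)
    then obtain e where "H' - H = {e}" by (auto simp: card_1_singleton_iff)
    then have "e \<in> G - H" "H' = insert e H" using H' by auto
    then show "H' \<in> (\<lambda>e. insert e H) ` (G - H)" by auto
  qed (use that fin in \<open>auto simp: S_def\<close>)
  have del: "\<exists>H. (H, H') \<in> S" if H': "H' \<subseteq> G" "card H' = Suc t" for H'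
  proof -
    obtain e where e: "e \<in> H'" using H' by fastforce
    have "(H' - {e}, H') \<in> S" using H' e fin by (auto simp: S_def)
    then show ?thesis ..
  qed
  have fst: "fst ` S = {H. H \<subseteq> G \<and> card H = t}"
  proof (intro equalityI subsetI)
    fix H assume H: "H \<in> {H. H \<subseteq> G \<and> card H = t}"
    then have "G - H \<noteq> {}" using t by auto
    then have "{H'. (H, H') \<in> S} \<noteq> {}" using H by (simp add: ins)
    then show "H \<in> fst ` S" by force
  qed (auto simp: S_def)
  have snd: "snd ` S = {H. H \<subseteq> G \<and> card H = Suc t}"
  proof (intro equalityI subsetI)
    fix H' assume "H' \<in> {H. H \<subseteq> G \<and> card H = Suc t}"
    then obtain H where "(H, H') \<in> S" using del by blast
    then show "H' \<in> snd ` S" by (rule image_eqI[rotated]) simp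
  qed (auto simp: S_def)
  have "{H. H \<subseteq> G \<and> card H = t} \<noteq> {}"
    using obtain_subset_with_card_n[of t G] t by fastforce
  then have "S \<noteq> {}" using fst by auto
  have inj: "inj_on (\<lambda>e. insert e H) (G - H)" for H by (auto simp: inj_on_def)
  have c1: "card {H'. (H, H') \<in> S} = card G - t" if "H \<in> fst ` S" for H
  proof -
    have H: "H \<subseteq> G" "card H = t" using that fst by auto
    then show ?thesis
      by (simp add: ins inj card_image card_Diff_subset fin)
  qed
  have c2: "card {H. (H, H') \<in> S} = Suc t choose t" if "H' \<in> snd ` S" for H'
  proof -
    have H: "H' \<subseteq> G" "card H' = Suc t" using that snd by auto
    then have "{H. (H, H') \<in> S} = {H. H \<subseteq> H' \<and> card H = t}" by (auto simp: S_def)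
    then show ?thesis using n_subsets[OF fin[OF H(1)], of t] H by simp
  qed
  have "bind_pmf (random_subset t G) (\<lambda>H. map_pmf (\<lambda>e. insert e H) (pmf_of_set (G - H)))
      = map_pmf snd (bind_pmf (pmf_of_set (fst ` S)) (\<lambda>H. map_pmf (Pair H) (pmf_of_set {H'. (H, H') \<in> S})))"
    unfolding random_subset_def fst map_bind_pmf map_pmf_comp
  proof (rule bind_pmf_cong, simp)
    fix H assume "H \<in> set_pmf (pmf_of_set {H. H \<subseteq> G \<and> card H = t})"
    then have H: "H \<subseteq> G" "card H = t"
      using \<open>{H. H \<subseteq> G \<and> card H = t} \<noteq> {}\<close> G by (simp_all add: set_pmf_of_set)
    then have "G - H \<noteq> {}" using t by auto
    then show "map_pmf (\<lambda>e. insert e H) (pmf_of_set (G - H)) = map_pmf (\<lambda>H'. snd (H, H')) (pmf_of_set {H'. (H, H') \<in> S})"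
      using G by (simp add: ins H map_pmf_of_set_inj inj pmf.map_ident)
  qed
  also have "\<dots> = map_pmf snd (bind_pmf (pmf_of_set (snd ` S)) (\<lambda>y. map_pmf (\<lambda>x. (x, y)) (pmf_of_set {x. (x, y) \<in> S})))"
    by (simp only: bind_pmf_of_set_fibres[OF \<open>finite S\<close> \<open>S \<noteq> {}\<close> c1]
      bind_pmf_of_set_swap_fibres[OF \<open>finite S\<close> \<open>S \<noteq> {}\<close> c2])
  also have "\<dots> = random_subset (Suc t) G"
    by (simp add: map_bind_pmf map_pmf_comp bind_return_pmf' snd random_subset_def)
  finally show ?thesis .
qed

lemma set_random_subset:
  assumes "finite G" "t \<le> card G"
  shows "set_pmf (random_subset t G) = {H. H \<subseteq> G \<and> card H = t}"
proof -
  have "{H. H \<subseteq> G \<and> card H = t} \<noteq> {}"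
    using obtain_subset_with_card_n[of t G] assms by fastforce
  then show ?thesis using assms by (simp add: random_subset_def)
qed

section \<open>The exposure process as a Markov chain\<close>

locale uniform_family =
  fixes \<F> :: "'a set set" and m :: nat
  assumes fin: "finite \<F>" and ne: "\<F> \<noteq> {}" and finG: "G \<in> \<F> \<Longrightarrow> finite G" and cardG: "G \<in> \<F> \<Longrightarrow> card G = m"
begin

definition \<mu> :: "nat \<Rightarrow> 'a set pmf" where
  "\<mu> t = bind_pmf (pmf_of_set \<F>) (random_subset t)"

definition above :: "'a set \<Rightarrow> 'a set set" where
  "above H = {G \<in> \<F>. H \<subseteq> G}"

text \<open>A fresh \<open>G\<close> is drawn above \<open>H\<close>, although the process already
  has one. By \<open>\<mu>_above\<close> the original \<open>G\<close> has just this conditional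
  law, so the exposed sets form a Markov chain with this kernel.\<close>

definition next_set :: "'a set \<Rightarrow> 'a set pmf" where
  "next_set H = bind_pmf (pmf_of_set (above H)) (\<lambda>G. map_pmf (\<lambda>e. insert e H) (pmf_of_set (G - H)))"

lemma set_\<mu>: "t \<le> m \<Longrightarrow> set_pmf (\<mu> t) = {H. above H \<noteq> {} \<and> card H = t}"
  using fin ne finG cardG by (auto simp: \<mu>_def set_random_subset above_def)

text \<open>Both sides are uniform on the pairs of a \<open>t\<close>-set and a member containing
  it: each member has \<open>m choose t\<close> such subsets, and conditioning a uniform pair on
  \<open>H\<close> leaves its second component uniform above \<open>H\<close>.\<close>

lemma \<mu>_above:
  assumes t: "t \<le> m"
  shows "bind_pmf (\<mu> t) (\<lambda>H. map_pmf (Pair H) (pmf_of_set (above H)))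
    = bind_pmf (pmf_of_set \<F>) (\<lambda>G. map_pmf (\<lambda>H. (H, G)) (random_subset t G))"
proof -
  define S where "S = {(H, G). G \<in> \<F> \<and> H \<subseteq> G \<and> card H = t}"
  have "S \<subseteq> Pow (\<Union>\<F>) \<times> \<F>" by (auto simp: S_def)
  then have "finite S" using fin finG by (rule_tac finite_subset) auto
  have ex: "\<exists>H\<subseteq>G. card H = t" if "G \<in> \<F>" for G
    using obtain_subset_with_card_n[of t G] t cardG[OF that] by metis
  have snd: "snd ` S = \<F>"
  proof (intro equalityI subsetI)
    fix G assume "G \<in> \<F>"
    then obtain H where "(H, G) \<in> S" using ex unfolding S_def by blast
    then show "G \<in> snd ` S" by (rule image_eqI[rotated]) simp
  qed (auto simp: S_def)
  then have "S \<noteq> {}" using ne by auto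
  have c2: "card {H. (H, G) \<in> S} = m choose t" if "G \<in> snd ` S" for G
    using n_subsets[OF finG, of G t] cardG[of G] that by (auto simp: S_def snd)
  have U: "bind_pmf (pmf_of_set \<F>) (\<lambda>G. map_pmf (\<lambda>H. (H, G)) (random_subset t G)) = pmf_of_set S"
  proof -
    have "bind_pmf (pmf_of_set \<F>) (\<lambda>G. map_pmf (\<lambda>H. (H, G)) (random_subset t G)) =
       bind_pmf (pmf_of_set (snd ` S)) (\<lambda>y. map_pmf (\<lambda>x. (x, y)) (pmf_of_set {x. (x, y) \<in> S}))"
      unfolding snd random_subset_def using fin ne
      by (intro bind_pmf_cong) (auto simp: S_def)
    then show ?thesis
      using bind_pmf_of_set_swap_fibres[OF \<open>finite S\<close> \<open>S \<noteq> {}\<close> c2] by simp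
  qed
  have \<mu>: "\<mu> t = map_pmf fst (pmf_of_set S)"
    unfolding U[symmetric] \<mu>_def map_bind_pmf map_pmf_comp by (simp add: pmf.map_ident)
  \<comment> \<open>The number of members above \<open>H\<close> varies with \<open>H\<close>, so
    the lemma on constant fibres does not apply on this side; the uniform pair is conditioned on its
    first component instead.\<close>
  have fib: "pmf_of_set (above H) = map_pmf snd (cond_pmf (pmf_of_set S) {z. fst z = H})" if "H \<in> fst ` S" for H
  proof -
    have 1: "S \<inter> {z. fst z = H} = Pair H ` above H" using that by (auto simp: S_def above_def)
    then have "cond_pmf (pmf_of_set S) {z. fst z = H} = pmf_of_set (Pair H ` above H)"
      using that \<open>finite S\<close> by (subst cond_pmf_of_set) auto
    also have "\<dots> = map_pmf (Pair H) (pmf_of_set (above H))"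
      using that fin by (intro map_pmf_of_set_inj[symmetric]) (auto simp: inj_on_def above_def S_def)
    finally show ?thesis by (simp add: map_pmf_comp pmf.map_ident)
  qed
  have "bind_pmf (\<mu> t) (\<lambda>H. map_pmf (Pair H) (pmf_of_set (above H))) =
     bind_pmf (\<mu> t) (\<lambda>H. cond_pmf (pmf_of_set S) {z. fst z = H})"
  proof (rule bind_pmf_cong, simp)
    fix H assume "H \<in> set_pmf (\<mu> t)"
    then have H: "H \<in> fst ` S" using \<open>finite S\<close> \<open>S \<noteq> {}\<close> by (simp add: \<mu>)
    then have ne': "set_pmf (pmf_of_set S) \<inter> {z. fst z = H} \<noteq> {}"
      using \<open>finite S\<close> \<open>S \<noteq> {}\<close> by auto
    show "map_pmf (Pair H) (pmf_of_set (above H)) = cond_pmf (pmf_of_set S) {z. fst z = H}"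
      unfolding fib[OF H] map_pmf_comp
    proof (rule map_pmf_idI)
      fix z assume "z \<in> set_pmf (cond_pmf (pmf_of_set S) {z. fst z = H})"
      then have "fst z = H" unfolding set_cond_pmf[OF ne'] by simp
      then show "(H, snd z) = z" by (simp add: prod_eq_iff)
    qed
  qed
  also have "\<dots> = pmf_of_set S"
  proof (rule bind_cond_pmf_cancel)
    fix H assume "H \<in> set_pmf (\<mu> t)"
    then show "set_pmf (pmf_of_set S) \<inter> {z. fst z = H} \<noteq> {}" by (auto simp: \<mu>)
  next
    fix z assume "z \<in> set_pmf (pmf_of_set S)"
    then show "set_pmf (\<mu> t) \<inter> {H. fst z = H} \<noteq> {}" by (auto simp: \<mu>)
  next
    fix H and z :: "'a set \<times> 'a set" assume "fst z = H"
    then show "measure (pmf_of_set S) {z. fst z = H} = measure (\<mu> t) {H. fst z = H}"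
      by (simp add: \<mu> vimage_def eq_commute)
  qed
  finally show ?thesis using U by simp
qed

lemma \<mu>_Suc: assumes "t < m" shows "bind_pmf (\<mu> t) next_set = \<mu> (Suc t)"
proof -
  have "bind_pmf (\<mu> t) next_set =
    bind_pmf (bind_pmf (\<mu> t) (\<lambda>H. map_pmf (Pair H) (pmf_of_set (above H))))
      (\<lambda>(H, G). map_pmf (\<lambda>e. insert e H) (pmf_of_set (G - H)))"
    by (simp add: next_set_def[abs_def] bind_assoc_pmf bind_map_pmf)
  also have "\<dots> = bind_pmf (pmf_of_set \<F>) (\<lambda>G. bind_pmf (random_subset t G)
     (\<lambda>H. map_pmf (\<lambda>e. insert e H) (pmf_of_set (G - H))))"
    using assms by (simp add: \<mu>_above bind_assoc_pmf bind_map_pmf)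
  also have "\<dots> = \<mu> (Suc t)"
    unfolding \<mu>_def using fin ne finG cardG assms
    by (intro bind_pmf_cong) (auto simp: random_subset_Suc)
  finally show ?thesis .
qed

lemma \<mu>_bind_above: assumes "t \<le> m" shows "bind_pmf (\<mu> t) (\<lambda>H. pmf_of_set (above H)) = pmf_of_set \<F>"
proof -
  have "bind_pmf (\<mu> t) (\<lambda>H. pmf_of_set (above H)) =
    map_pmf snd (bind_pmf (\<mu> t) (\<lambda>H. map_pmf (Pair H) (pmf_of_set (above H))))"
    by (simp add: map_bind_pmf map_pmf_comp pmf.map_ident)
  also have "\<dots> = pmf_of_set \<F>"
    using assms by (simp add: \<mu>_above map_bind_pmf map_pmf_comp bind_return_pmf')
  finally show ?thesis .
qed

text \<open>All members above \<open>H\<close> have the same number \<open>m - card H\<close> of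
  unexposed elements, so the chance that \<open>e\<close> comes next is the chance that
  \<open>e\<close> is present times a common constant.\<close>

lemma pmf_next_set:
  assumes H: "above H \<noteq> {}" "card H < m" and e: "e \<notin> H"
  shows "pmf (next_set H) (insert e H) = card {G \<in> above H. e \<in> G} / card (above H) / (m - card H)"
proof -
  have fa: "finite (above H)" using fin by (simp add: above_def)
  have "pmf (map_pmf (\<lambda>e. insert e H) (pmf_of_set (G - H))) (insert e H) = (if e \<in> G then 1 / (m - card H) else 0)"
    if "G \<in> above H" for G
  proof -
    have G: "G \<in> \<F>" "H \<subseteq> G" using that by (auto simp: above_def)
    then have c: "card (G - H) = m - card H" "finite G"
      using finG cardG by (auto simp: card_Diff_subset finite_subset)
    then have "card (G - H) > 0" using H by simp
    then have *: "G - H \<noteq> {}" by (rule card_gt_0_iff[THEN iffD1, THEN conjunct1])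
    have "(\<lambda>e. insert e H) -` {insert e H} \<inter> (G - H) = {e} \<inter> G" using e by auto
    then show ?thesis using * c by (simp add: pmf_map measure_pmf_of_set Int_commute)
  qed
  then have "pmf (next_set H) (insert e H) = (\<Sum>G\<in>above H. if e \<in> G then 1 / (m - card H) else 0) / card (above H)"
    unfolding next_set_def using H fa by (simp add: pmf_bind_pmf_of_set cong: sum.cong)
  also have "(\<Sum>G\<in>above H. if e \<in> G then 1 / (m - card H) else 0) = (\<Sum>G\<in>{G\<in>above H. e \<in> G}. 1 / real (m - card H))"
    using fa by (subst sum.inter_filter[symmetric]) auto
  finally show ?thesis by simp
qed

lemma next_set_support:
  assumes H: "above H \<noteq> {}" "card H < m"
  shows "finite (set_pmf (next_set H))" "H' \<in> set_pmf (next_set H) \<Longrightarrow> \<exists>e. e \<notin> H \<and> H' = insert e H"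
proof -
  have fa: "finite (above H)" using fin by (simp add: above_def)
  have G: "finite (G - H)" "G - H \<noteq> {}" if "G \<in> above H" for G
  proof -
    have G: "G \<in> \<F>" "H \<subseteq> G" using that by (auto simp: above_def)
    then have c: "card (G - H) = m - card H" "finite G"
      using finG cardG by (auto simp: card_Diff_subset finite_subset)
    then have "card (G - H) > 0" using H by simp
    then show "finite (G - H)" "G - H \<noteq> {}" by (simp_all add: card_gt_0_iff)
  qed
  have "set_pmf (next_set H) = (\<Union>G\<in>above H. (\<lambda>e. insert e H) ` (G - H))"
    unfolding next_set_def using fa H G by simp
  then show "finite (set_pmf (next_set H))" "H' \<in> set_pmf (next_set H) \<Longrightarrow> \<exists>e. e \<notin> H \<and> H' = insert e H"
    using fa G by auto
qed

end

section \<open>Coupling independent draws into the exposure\<close>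

primrec union_pmf :: "'a set pmf \<Rightarrow> nat \<Rightarrow> 'a set pmf" where
  "union_pmf \<kappa> 0 = return_pmf {}"
| "union_pmf \<kappa> (Suc t) = bind_pmf (union_pmf \<kappa> t) (\<lambda>L. map_pmf (\<lambda>Y. L \<union> Y) \<kappa>)"

text \<open>Through \<open>pmf_next_set\<close>, \<open>good\<close> is the pointwise inequality
  that \<open>one_point_coupling\<close> needs, so step \<open>t\<close> adds a failure only on
  \<open>B t\<close>. The bad sets are measured under the exposure process alone. After
  \<open>T\<close> steps the exposed set is completed to a full member, which is uniform by
  \<open>\<mu>_bind_above\<close>.\<close>

lemma (in uniform_family) approx_dominated_uniform:
  assumes Y: "\<And>Y. Y \<in> set_pmf \<kappa> \<Longrightarrow> Y = {} \<or> (\<exists>e. Y = {e})" and emp: "{} \<in> set_pmf \<kappa>"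
    and T: "T \<le> m"
    and good: "\<And>t H e. t < T \<Longrightarrow> above H \<noteq> {} \<Longrightarrow> card H = t \<Longrightarrow> H \<notin> B t \<Longrightarrow> e \<notin> H \<Longrightarrow>
      pmf \<kappa> {e} \<le> real (card {G \<in> above H. e \<in> G}) / real (card (above H)) / real (m - t)"
    and bad: "\<And>t. t < T \<Longrightarrow> measure_pmf.prob (\<mu> t) (B t) \<le> \<beta>"
  shows "approx_dominated (union_pmf \<kappa> T) (pmf_of_set \<F>) (real T * \<beta>)"
proof -
  have "approx_dominated (union_pmf \<kappa> t) (\<mu> t) (real t * \<beta>)" if "t \<le> T" for t
    using that
  proof (induction t)
    case 0
    have "approx_dominated (return_pmf {}) (\<mu> 0) 0"
      unfolding approx_dominated_def
      by (intro exI[of _ "map_pmf (Pair {}) (\<mu> 0)"]) (auto simp: map_pmf_comp pmf.map_ident)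
    then show ?case by simp
  next
    case (Suc t)
    have t: "t < T" "t < m" using Suc.prems T by auto
    have "approx_dominated (bind_pmf (union_pmf \<kappa> t) (\<lambda>L. map_pmf (\<lambda>Y. L \<union> Y) \<kappa>)) (bind_pmf (\<mu> t) next_set)
      (real t * \<beta> + measure_pmf.prob (\<mu> t) (B t))"
    proof (rule approx_dominated_bind_Un)
      fix H assume H: "H \<in> set_pmf (\<mu> t)" "H \<notin> B t"
      then have H': "above H \<noteq> {}" "card H = t" "card H < m" using t by (auto simp: set_\<mu>)
      show "\<exists>C. map_pmf fst C = \<kappa> \<and> map_pmf snd C = next_set H \<and> (\<forall>(Y, H') \<in> set_pmf C. Y \<union> H \<subseteq> H')"
        using next_set_support[OF H'(1,3)] Y emp good[OF t(1) H'(1,2) H(2)] H'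
        by (intro one_point_coupling) (auto simp: pmf_next_set)
    qed (use Suc t in auto)
    then show ?case
      using bad[OF t(1)] t by (auto simp: \<mu>_Suc algebra_simps elim!: approx_dominated_mono)
  qed
  note dom = this[OF order.refl]
  have "approx_dominated (union_pmf \<kappa> T) (bind_pmf (\<mu> T) (\<lambda>H. pmf_of_set (above H))) (real T * \<beta>)"
  proof (rule approx_dominated_supersets[OF dom])
    fix H G assume "H \<in> set_pmf (\<mu> T)" "G \<in> set_pmf (pmf_of_set (above H))"
    then have "G \<in> above H" using T fin by (simp add: set_\<mu> above_def)
    then show "H \<subseteq> G" by (simp add: above_def)
  qed
  then show ?thesis using T by (simp add: \<mu>_bind_above)
qed

section \<open>Poissonisation and tail bounds\<close>

lemma set_union_pmf:
  assumes "\<And>Y. Y \<in> set_pmf \<kappa> \<Longrightarrow> Y \<subseteq> E"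
  shows "L \<in> set_pmf (union_pmf \<kappa> t) \<Longrightarrow> L \<subseteq> E"
  using assms by (induction t arbitrary: L) fastforce+

lemma measure_union_pmf: "measure (union_pmf \<kappa> t) {L. L \<subseteq> A} = measure \<kappa> {Y. Y \<subseteq> A} ^ t"
proof (induction t)
  case (Suc t)
  have "measure (union_pmf \<kappa> (Suc t)) {L. L \<subseteq> A} = (\<integral>L. measure \<kappa> {Y. L \<union> Y \<subseteq> A} \<partial>union_pmf \<kappa> t)"
    by (simp add: measure_bind_pmf vimage_def)
  also have "\<dots> = (\<integral>L. indicator {L. L \<subseteq> A} L * measure \<kappa> {Y. Y \<subseteq> A} \<partial>union_pmf \<kappa> t)"
    by (intro Bochner_Integration.integral_cong) (auto split: split_indicator)
  also have "\<dots> = measure \<kappa> {Y. Y \<subseteq> A} ^ Suc t"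
    using Suc by simp
  finally show ?case .
qed simp

text \<open>Moebius inversion on the subset lattice, done by induction on \<open>A\<close>. These
  probabilities are convenient because they factor both for unions of independent draws and for
  independent edges.\<close>

lemma pmf_eq_if_subset_probs_eq:
  assumes E: "finite E" and pE: "\<And>L. L \<in> set_pmf p \<Longrightarrow> L \<subseteq> E" and qE: "\<And>L. L \<in> set_pmf q \<Longrightarrow> L \<subseteq> E"
    and eq: "\<And>A. A \<subseteq> E \<Longrightarrow> measure p {L. L \<subseteq> A} = measure q {L. L \<subseteq> A}"
  shows "p = q"
proof -
  have *: "pmf p A = pmf q A" if "A \<subseteq> E" for A
    using finite_subset[OF that E] that
  proof (induction A rule: finite_psubset_induct)
    case (psubset A)
    have S: "measure r {L. L \<subseteq> A} = pmf r A + sum (pmf r) (Pow A - {A})" for r :: "'a set pmf"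
    proof -
      have "measure r {L. L \<subseteq> A} = sum (pmf r) (Pow A)"
        using psubset(1) by (subst measure_measure_pmf_finite[symmetric]) (auto simp: Pow_def)
      then show ?thesis using psubset(1) by (subst (asm) sum.remove[of _ A]) auto
    qed
    have "sum (pmf p) (Pow A - {A}) = sum (pmf q) (Pow A - {A})"
      using psubset by (intro sum.cong) auto
    then show ?case using eq[OF psubset.prems] S[of p] S[of q] by simp
  qed
  show ?thesis
  proof (rule pmf_eqI)
    fix A show "pmf p A = pmf q A"
      using * pE qE by (cases "A \<subseteq> E") (metis pmf_eq_0_set_pmf)+
  qed
qed

lemma set_random_graph_matrix: "L \<in> set_pmf (random_graph_matrix n W) \<Longrightarrow> L \<subseteq> all_edges n"
  by (auto simp: random_graph_matrix_def)

lemma measure_random_graph_matrix_subset: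
  assumes W: "\<And>e. e \<in> all_edges n \<Longrightarrow> 0 \<le> W (Min e) (Max e) \<and> W (Min e) (Max e) \<le> 1"
  shows "measure (random_graph_matrix n W) {L. L \<subseteq> A} = (\<Prod>e\<in>all_edges n - A. 1 - W (Min e) (Max e))"
proof -
  let ?E = "all_edges n"
  have "measure (random_graph_matrix n W) {L. L \<subseteq> A} =
      measure (Pi_pmf ?E False (\<lambda>e. bernoulli_pmf (W (Min e) (Max e)))) (Pi ?E (\<lambda>e. if e \<in> A then UNIV else {False}))"
    unfolding random_graph_matrix_def measure_map_pmf
    by (rule arg_cong[of _ _ "measure _"]) (auto simp: Pi_def)
  also have "\<dots> = (\<Prod>e\<in>?E. if e \<in> A then 1 else 1 - W (Min e) (Max e))"
    using W by (subst measure_Pi_pmf_Pi) (auto simp: finite_all_edges measure_pmf_single intro!: prod.cong)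
  also have "\<dots> = (\<Prod>e\<in>?E - A. 1 - W (Min e) (Max e))"
    by (intro prod.mono_neutral_cong_right) (auto simp: finite_all_edges)
  finally show ?thesis .
qed

lemma poisson_pgf:
  assumes l: "0 < l" and x: "0 \<le> x"
  shows "integrable (poisson_pmf l) (\<lambda>k. x ^ k)" "(\<integral>k. x ^ k \<partial>poisson_pmf l) = exp (l * (x - 1))"
proof -
  have s: "(\<lambda>k. pmf (poisson_pmf l) k * x ^ k) sums exp (l * (x - 1))"
  proof -
    have "(\<lambda>k. (l * x) ^ k /\<^sub>R fact k * exp (- l)) sums (exp (l * x) * exp (- l))"
      by (intro sums_mult2 exp_converges)
    moreover have "exp (l * x) * exp (- l) = exp (l * (x - 1))"
      by (simp add: exp_add[symmetric] algebra_simps)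
    ultimately show ?thesis using l by (simp add: power_mult_distrib field_simps)
  qed
  have "\<bar>pmf (poisson_pmf l) k * x ^ k\<bar> = pmf (poisson_pmf l) k * x ^ k" for k using x by simp
  then have int: "integrable (count_space UNIV) (\<lambda>k. pmf (poisson_pmf l) k * x ^ k)"
    unfolding integrable_count_space_nat_iff using sums_summable[OF s] by (simp only: real_norm_def)
  then show "integrable (poisson_pmf l) (\<lambda>k. x ^ k)"
    by (simp add: measure_pmf_eq_density integrable_density)
  have "(\<integral>k. x ^ k \<partial>poisson_pmf l) = (\<integral>k. pmf (poisson_pmf l) k * x ^ k \<partial>count_space UNIV)"
    by (simp add: measure_pmf_eq_density integral_density)
  also have "\<dots> = exp (l * (x - 1))"
    using sums_integral_count_space_nat[OF int] s by (rule sums_unique2)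
  finally show "(\<integral>k. x ^ k \<partial>poisson_pmf l) = exp (l * (x - 1))" .
qed

text \<open>Poisson thinning: the numbers of times the edges are drawn are independent Poisson
  variables with means \<open>l * pmf \<kappa> {e}\<close>, and an edge is present unless its count
  is 0. The proof needs no counts: the chance that no draw leaves \<open>A\<close> is the generating
  function of the Poisson law at the chance that one draw stays in \<open>A\<close>, and the
  exponential turns the sum over edges outside \<open>A\<close> into a product.\<close>

lemma poisson_mixture_union_pmf:
  assumes l: "0 < l" and E: "\<And>e. e \<in> all_edges n \<Longrightarrow> W (Min e) (Max e) = 1 - exp (- (l * pmf \<kappa> {e}))"
    and Y: "\<And>Y. Y \<in> set_pmf \<kappa> \<Longrightarrow> Y = {} \<or> (\<exists>e\<in>all_edges n. Y = {e})"
  shows "bind_pmf (poisson_pmf l) (union_pmf \<kappa>) = random_graph_matrix n W"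
proof (rule pmf_eq_if_subset_probs_eq[OF finite_all_edges])
  have "Y \<in> set_pmf \<kappa> \<Longrightarrow> Y \<subseteq> all_edges n" for Y using Y by blast
  then show "L \<in> set_pmf (bind_pmf (poisson_pmf l) (union_pmf \<kappa>)) \<Longrightarrow> L \<subseteq> all_edges n" for L
    using set_union_pmf[of \<kappa> "all_edges n"] by (simp only: set_bind_pmf) blast
  show "L \<in> set_pmf (random_graph_matrix n W) \<Longrightarrow> L \<subseteq> all_edges n" for L
    by (rule set_random_graph_matrix)
next
  fix A assume A: "A \<subseteq> all_edges n"
  let ?x = "measure \<kappa> {Y. Y \<subseteq> A}"
  have x: "?x = 1 - (\<Sum>e\<in>all_edges n - A. pmf \<kappa> {e})"
  proof -
    have "?x = 1 - measure \<kappa> {Y. \<not> Y \<subseteq> A}"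
    proof -
      have eq: "{Y. Y \<subseteq> A} = space (measure_pmf \<kappa>) - {Y. \<not> Y \<subseteq> A}" by auto
      show ?thesis unfolding eq by (subst measure_pmf.prob_compl) auto
    qed
    also have "measure \<kappa> {Y. \<not> Y \<subseteq> A} = measure \<kappa> ((\<lambda>e. {e}) ` (all_edges n - A))"
      by (rule measure_prob_cong_0) (use Y in \<open>auto simp: pmf_eq_0_set_pmf\<close>)
    also have "\<dots> = (\<Sum>e\<in>all_edges n - A. pmf \<kappa> {e})"
      by (subst measure_measure_pmf_finite) (auto simp: sum.reindex finite_all_edges)
    finally show ?thesis .
  qed
  have "measure (bind_pmf (poisson_pmf l) (union_pmf \<kappa>)) {L. L \<subseteq> A} = (\<integral>k. ?x ^ k \<partial>poisson_pmf l)"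
    by (simp add: measure_bind_pmf measure_union_pmf)
  also have "\<dots> = exp (l * (?x - 1))" using l by (rule poisson_pgf) simp
  also have "\<dots> = exp (\<Sum>e\<in>all_edges n - A. - (l * pmf \<kappa> {e}))"
    by (simp add: x sum_negf sum_distrib_left)
  also have "\<dots> = (\<Prod>e\<in>all_edges n - A. 1 - W (Min e) (Max e))"
    by (subst exp_sum) (auto simp: E finite_all_edges)
  also have "\<dots> = measure (random_graph_matrix n W) {L. L \<subseteq> A}"
    using l by (intro measure_random_graph_matrix_subset[symmetric]) (auto simp: E)
  finally show "measure (bind_pmf (poisson_pmf l) (union_pmf \<kappa>)) {L. L \<subseteq> A} =
      measure (random_graph_matrix n W) {L. L \<subseteq> A}" .
qed

section \<open>Tail bounds by exponential moments\<close>

lemma poisson_upper_tail: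
  assumes l: "0 < l" and z: "1 \<le> z"
  shows "measure (poisson_pmf l) {k. T \<le> real k} \<le> exp (l * (z - 1)) * z powr (- T)"
proof -
  have "0 \<le> z" using z by simp
  note pgf = poisson_pgf[OF l this]
  have "measure (poisson_pmf l) {k. T \<le> real k} = (\<integral>k. indicator {k. T \<le> real k} k \<partial>poisson_pmf l)"
    by simp
  also have "\<dots> \<le> (\<integral>k. z ^ k * z powr (- T) \<partial>poisson_pmf l)"
  proof (rule integral_mono)
    show "indicator {k. T \<le> real k} k \<le> z ^ k * z powr (- T)" for k
      using z by (auto simp: powr_realpow[symmetric] powr_add[symmetric] ge_one_powr_ge_zero split: split_indicator)
  qed (use pgf in \<open>auto intro!: measure_pmf.integrable_const_bound[where B = 1]\<close>)
  also have "\<dots> = exp (l * (z - 1)) * z powr (- T)" using pgf by simp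
  finally show ?thesis .
qed

text \<open>Sampling without replacement: a fixed \<open>a\<close>-set lies in a random
  \<open>t\<close>-subset with probability the product of (t - i) / (m - i) over i < a, and no
  factor exceeds t / m.\<close>

lemma choose_diff_le:
  assumes "a \<le> t" "t \<le> m"
  shows "real ((m - a) choose (t - a)) \<le> real (m choose t) * (real t / real m) ^ a"
  using assms(1)
proof (induction a)
  case (Suc a)
  have a: "Suc (m - Suc a) = m - a" "Suc (t - Suc a) = t - a" using Suc.prems assms by auto
  have "(t - a) * ((m - a) choose (t - a)) = (m - a) * ((m - Suc a) choose (t - Suc a))"
    using Suc_times_binomial_eq[of "m - Suc a" "t - Suc a"] unfolding a by (simp add: mult.commute)
  then have "real (t - a) * real ((m - a) choose (t - a)) = real (m - a) * real ((m - Suc a) choose (t - Suc a))"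
    by (metis of_nat_mult)
  then have "real ((m - Suc a) choose (t - Suc a)) = real ((m - a) choose (t - a)) * (real (t - a) / real (m - a))"
    using Suc.prems assms by (simp add: field_simps)
  also have "\<dots> \<le> (real (m choose t) * (real t / real m) ^ a) * (real t / real m)"
  proof (rule mult_mono)
    have "a * t \<le> a * m" using assms by simp
    then have "real a * real t \<le> real a * real m" by (metis of_nat_mult of_nat_le_iff)
    then show "real (t - a) / real (m - a) \<le> real t / real m"
      using Suc.prems assms by (simp add: of_nat_diff field_simps)
  qed (use Suc in auto)
  finally show ?case by (simp add: mult_ac)
qed simp

text \<open>The hypergeometric moment is bounded by the binomial one. Expanding
  \<open>(1 + x) ^ card (H \<inter> D)\<close> over the subsets \<open>A\<close> of the intersection
  leaves only inclusion probabilities with nonnegative weights, and \<open>choose_diff_le\<close>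
  compares these with independent sampling.\<close>

lemma random_subset_mgf:
  fixes x :: real
  assumes G: "finite G" "D \<subseteq> G" and t: "t \<le> card G" and x: "0 \<le> x"
  shows "(\<integral>H. (1 + x) ^ card (H \<inter> D) \<partial>measure_pmf (random_subset t G)) \<le> (1 + x * (real t / real (card G))) ^ card D"
proof -
  define \<H> where "\<H> = {H. H \<subseteq> G \<and> card H = t}"
  have fH: "finite \<H>" unfolding \<H>_def using G by simp
  have cH: "card \<H> = card G choose t" unfolding \<H>_def using n_subsets[OF G(1)] by simp
  have neH: "\<H> \<noteq> {}" using set_random_subset[OF G(1) t] set_pmf_not_empty[of "random_subset t G"]
    by (simp add: \<H>_def)
  have fD: "finite D" using G finite_subset by blast
  have pow: "(\<Prod>_\<in>C. c + 1) = (\<Sum>A\<in>Pow C. c ^ card A)" if "finite C" for C :: "'a set" and c :: real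
    using prod_add[OF that, of "\<lambda>_. c" "\<lambda>_. 1"] by simp
  have "(\<Sum>H\<in>\<H>. (1 + x) ^ card (H \<inter> D)) = (\<Sum>H\<in>\<H>. \<Sum>A\<in>Pow (H \<inter> D). x ^ card A)"
    using pow[of "_ \<inter> D" x] fD by (intro sum.cong) (simp_all add: add.commute)
  also have "\<dots> = (\<Sum>H\<in>\<H>. \<Sum>A\<in>Pow D. if A \<subseteq> H then x ^ card A else 0)"
    using fD by (intro sum.cong refl sum.mono_neutral_cong_left) auto
  also have "\<dots> = (\<Sum>A\<in>Pow D. \<Sum>H\<in>\<H>. if A \<subseteq> H then x ^ card A else 0)"
    by (rule sum.swap)
  also have "\<dots> = (\<Sum>A\<in>Pow D. x ^ card A * real (card {H \<in> \<H>. A \<subseteq> H}))"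
    using fH by (intro sum.cong) (simp_all add: sum.inter_filter[symmetric])
  also have "\<dots> \<le> (\<Sum>A\<in>Pow D. x ^ card A * (real (card \<H>) * (real t / real (card G)) ^ card A))"
  proof (intro sum_mono mult_left_mono)
    fix A assume A: "A \<in> Pow D"
    show "real (card {H \<in> \<H>. A \<subseteq> H}) \<le> real (card \<H>) * (real t / real (card G)) ^ card A"
    proof (cases "card A \<le> t")
      case True
      have "{H \<in> \<H>. A \<subseteq> H} = {H. A \<subseteq> H \<and> H \<subseteq> G \<and> card H = t}" by (auto simp: \<H>_def)
      moreover have "A \<subseteq> G" using A G by auto
      ultimately show ?thesis using card_subsets_containing[OF G(1) _ True] choose_diff_le[OF True t] by (simp add: cH)
    next
      case False
      have "{H \<in> \<H>. A \<subseteq> H} = {}"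
        using False card_mono[OF finite_subset[OF _ G(1)]] by (auto simp: \<H>_def)
      then show ?thesis by (simp only: card.empty) simp
    qed
  qed (use x in auto)
  also have "\<dots> = real (card \<H>) * (\<Sum>A\<in>Pow D. (x * (real t / real (card G))) ^ card A)"
    by (simp add: sum_distrib_left power_mult_distrib power_divide algebra_simps)
  also have "\<dots> = real (card \<H>) * (1 + x * (real t / real (card G))) ^ card D"
    using pow[OF fD, of "x * (real t / real (card G))"] by (simp add: add.commute)
  finally have "(\<Sum>H\<in>\<H>. (1 + x) ^ card (H \<inter> D)) / real (card \<H>) \<le> (1 + x * (real t / real (card G))) ^ card D"
    using fH neH by (simp add: field_simps card_gt_0_iff)
  then show ?thesis using fH neH unfolding random_subset_def \<H>_def[symmetric]
    by (simp add: integral_pmf_of_set)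
qed

lemma random_subset_upper_tail:
  fixes x :: real
  assumes G: "finite G" "D \<subseteq> G" and t: "t \<le> card G" and x: "0 \<le> x"
  shows "measure_pmf.prob (random_subset t G) {H. a \<le> real (card (H \<inter> D))} \<le> (1 + x * (real t / real (card G))) ^ card D * (1 + x) powr (- a)"
proof -
  have fin: "finite (set_pmf (random_subset t G))" using set_random_subset[OF G(1) t] G by simp
  have "measure_pmf.prob (random_subset t G) {H. a \<le> real (card (H \<inter> D))} =
     (\<integral>H. indicator {H. a \<le> real (card (H \<inter> D))} H \<partial>measure_pmf (random_subset t G))" by simp
  also have "\<dots> \<le> (\<integral>H. (1 + x) ^ card (H \<inter> D) * (1 + x) powr (- a) \<partial>measure_pmf (random_subset t G))"
  proof (rule integral_mono)
    show "indicator {H. a \<le> real (card (H \<inter> D))} H \<le> (1 + x) ^ card (H \<inter> D) * (1 + x) powr (- a)" for H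
      using x by (auto simp: powr_realpow[symmetric] powr_add[symmetric] ge_one_powr_ge_zero split: split_indicator)
  qed (use fin in \<open>auto intro!: integrable_measure_pmf_finite\<close>)
  also have "\<dots> = (\<integral>H. (1 + x) ^ card (H \<inter> D) \<partial>measure_pmf (random_subset t G)) * (1 + x) powr (- a)"
    using fin by simp
  also have "\<dots> \<le> (1 + x * (real t / real (card G))) ^ card D * (1 + x) powr (- a)"
    using random_subset_mgf[OF G t x] by (intro mult_right_mono) auto
  finally show ?thesis .
qed

section \<open>Switchings\<close>

lemma doubleton_in_all_edges [simp]: "{a, b} \<in> all_edges n \<longleftrightarrow> a \<in> {1..n} \<and> b \<in> {1..n} \<and> a \<noteq> b"
  by (auto simp: all_edges_def doubleton_eq_iff)

lemma edgeE:
  assumes "e \<in> all_edges n"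
  obtains j k where "e = {j, k}" "j \<in> {1..n}" "k \<in> {1..n}" "j \<noteq> k"
  using assms by (auto simp: all_edges_def)

lemma handshake:
  assumes R: "R \<subseteq> all_edges n"
  shows "(\<Sum>i\<in>{1..n}. vertex_degree R i) = 2 * card R"
proof -
  have fin: "finite R" using R finite_all_edges finite_subset by blast
  have "(\<Sum>i\<in>{1..n}. vertex_degree R i) = (\<Sum>i\<in>{1..n}. \<Sum>e\<in>R. if i \<in> e then 1 else 0)"
    using fin by (simp add: vertex_degree_def sum.inter_filter[symmetric])
  also have "\<dots> = (\<Sum>e\<in>R. \<Sum>i\<in>{1..n}. if i \<in> e then 1 else 0)"
    by (rule sum.swap)
  also have "\<dots> = (\<Sum>e\<in>R. 2)"
  proof (rule sum.cong)
    fix e assume "e \<in> R"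
    then obtain j k where e: "e = {j, k}" "j \<in> {1..n}" "k \<in> {1..n}" "j \<noteq> k"
      using R edgeE by blast
    have "(\<Sum>i\<in>{1..n}. if i \<in> e then 1 else 0 :: nat) = card {i \<in> {1..n}. i \<in> e}"
      by (simp add: sum.inter_filter[symmetric])
    also have "{i \<in> {1..n}. i \<in> e} = {j, k}" using e by auto
    finally show "(\<Sum>i\<in>{1..n}. if i \<in> e then 1 else 0 :: nat) = 2" using e by simp
  qed simp
  finally show ?thesis by simp
qed

lemma card_neighbours:
  assumes R: "R \<subseteq> all_edges n"
  shows "finite {x. {v, x} \<in> R}" "card {x. {v, x} \<in> R} = vertex_degree R v"
proof -
  have "{x. {v, x} \<in> R} \<subseteq> {1..n}" using R by auto
  then show "finite {x. {v, x} \<in> R}" using finite_subset by blast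
  have "bij_betw (\<lambda>x. {v, x}) {x. {v, x} \<in> R} {e \<in> R. v \<in> e}"
    unfolding bij_betw_def
  proof
    show "inj_on (\<lambda>x. {v, x}) {x. {v, x} \<in> R}" by (auto simp: inj_on_def doubleton_eq_iff)
    show "(\<lambda>x. {v, x}) ` {x. {v, x} \<in> R} = {e \<in> R. v \<in> e}"
    proof (intro equalityI subsetI)
      fix e assume "e \<in> {e \<in> R. v \<in> e}"
      then have e: "e \<in> R" "v \<in> e" by auto
      then obtain j k where "e = {j, k}" using R edgeE by blast
      then have "e = {v, j} \<or> e = {v, k}" using e by auto
      then show "e \<in> (\<lambda>x. {v, x}) ` {x. {v, x} \<in> R}" using e by auto
    qed auto
  qed
  then show "card {x. {v, x} \<in> R} = vertex_degree R v"
    unfolding vertex_degree_def by (rule bij_betw_same_card)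
qed

text \<open>Edges carry an orientation because a switching treats the two ends of \<open>yv\<close>
  differently, and undoing it requires knowing which end of each new edge is which.\<close>

definition arcs :: "edge_set \<Rightarrow> (nat \<times> nat) set" where
  "arcs R = {(x, y). {x, y} \<in> R}"

lemma card_arcs:
  assumes R: "R \<subseteq> all_edges n"
  shows "finite (arcs R)" "card (arcs R) = 2 * card R"
proof -
  have eq: "arcs R = Sigma {1..n} (\<lambda>x. {y. {x, y} \<in> R})"
    using R by (auto simp: arcs_def)
  show "finite (arcs R)" unfolding eq using card_neighbours[OF R] by blast
  show "card (arcs R) = 2 * card R"
    unfolding eq handshake[OF R, symmetric] using card_neighbours[OF R] by (subst card_SigmaI) auto
qed

lemma vertex_degree_exchange:
  assumes "finite G" "Rm \<subseteq> G" "Ad \<inter> G = {}" "finite Ad"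
    and "vertex_degree Rm i = vertex_degree Ad i"
  shows "vertex_degree ((G - Rm) \<union> Ad) i = vertex_degree G i"
proof -
  have f: "finite {e \<in> G. i \<in> e}" "finite {e \<in> Ad. i \<in> e}" using assms by auto
  have "{e \<in> (G - Rm) \<union> Ad. i \<in> e} = ({e \<in> G. i \<in> e} - {e \<in> Rm. i \<in> e}) \<union> {e \<in> Ad. i \<in> e}" by auto
  then have "vertex_degree ((G - Rm) \<union> Ad) i = card ({e \<in> G. i \<in> e} - {e \<in> Rm. i \<in> e}) + card {e \<in> Ad. i \<in> e}"
    using f assms(3) unfolding vertex_degree_def by (simp only:) (subst card_Un_disjoint, auto)
  also have "card ({e \<in> G. i \<in> e} - {e \<in> Rm. i \<in> e}) = card {e \<in> G. i \<in> e} - card {e \<in> Rm. i \<in> e}"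
    using assms by (intro card_Diff_subset) (auto intro: finite_subset)
  also have "card {e \<in> Rm. i \<in> e} \<le> card {e \<in> G. i \<in> e}"
    using assms f by (intro card_mono) auto
  ultimately show ?thesis using assms(5) card_mono[OF f(1), of "{e \<in> Rm. i \<in> e}"] assms(2)
    unfolding vertex_degree_def by fastforce
qed

lemma vertex_degree_insert:
  assumes "finite E" "{a, b} \<notin> E" "a \<noteq> b"
  shows "vertex_degree (insert {a, b} E) i = of_bool (i = a) + of_bool (i = b) + vertex_degree E i"
proof -
  have "{e \<in> insert {a, b} E. i \<in> e} = (if i \<in> {a, b} then insert {a, b} {e \<in> E. i \<in> e} else {e \<in> E. i \<in> e})"
    by auto
  then show ?thesis using assms by (auto simp: vertex_degree_def)
qed

text \<open>The removed edges avoid \<open>H\<close>, so \<open>H\<close> survives the switch. The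
  non-adjacency conditions keep the result simple and, for distinct nonadjacent \<open>j\<close> and
  \<open>k\<close>, also force all six edges involved to be distinct.\<close>

definition switches :: "nat \<Rightarrow> nat \<Rightarrow> edge_set \<Rightarrow> edge_set \<Rightarrow> ((nat \<times> nat) \<times> (nat \<times> nat)) set" where
  "switches j k H G = {((x, y), (u, v)). {j, x} \<in> G - H \<and> {k, u} \<in> G - H \<and> {y, v} \<in> G - H \<and>
     x \<noteq> y \<and> {x, y} \<notin> G \<and> u \<noteq> v \<and> {u, v} \<notin> G}"

text \<open>Choose residual neighbours \<open>x\<close> of \<open>j\<close> and \<open>u\<close> of
  \<open>k\<close>, and then one of the \<open>2 * card (G - H)\<close> residual arcs
  \<open>(y, v)\<close>. The arc is spoiled if \<open>y\<close> equals or is adjacent to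
  \<open>x\<close>, which leaves at most \<open>\<Delta> + 1\<close> choices of \<open>y\<close> and
  \<open>\<Delta>\<close> of \<open>v\<close>, and symmetrically for \<open>v\<close> and
  \<open>u\<close>.\<close>

lemma card_switches_ge:
  assumes G: "G \<subseteq> all_edges n" and D: "\<And>i. i \<in> {1..n} \<Longrightarrow> vertex_degree G i \<le> \<Delta>"
  shows "vertex_degree (G - H) j * vertex_degree (G - H) k * (2 * card (G - H) - 2 * (\<Delta> * (\<Delta> + 1)))
    \<le> card (switches j k H G)"
proof -
  let ?R = "G - H"
  have R: "?R \<subseteq> all_edges n" using G by auto
  define X where "X = (\<lambda>v. {x. {v, x} \<in> ?R})"
  define bad1 where "bad1 = (\<lambda>x. {(y, v) \<in> arcs ?R. y = x \<or> {x, y} \<in> G})"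
  define bad2 where "bad2 = (\<lambda>u. {(y, v) \<in> arcs ?R. v = u \<or> {u, v} \<in> G})"
  have Dall: "vertex_degree G i \<le> \<Delta>" for i
  proof (cases "i \<in> {1..n}")
    case False
    then have "{e \<in> G. i \<in> e} = {}" using G by (auto elim!: edgeE dest!: subsetD)
    then have "vertex_degree G i = 0" unfolding vertex_degree_def by (simp only: card.empty)
    then show ?thesis by simp
  qed (rule D)
  have bad1: "card (bad1 x) \<le> \<Delta> * (\<Delta> + 1)" for x
  proof -
    have "bad1 x \<subseteq> Sigma (insert x {y. {x, y} \<in> G}) (\<lambda>y. {v. {y, v} \<in> G})"
      by (auto simp: bad1_def arcs_def)
    then have "card (bad1 x) \<le> card (Sigma (insert x {y. {x, y} \<in> G}) (\<lambda>y. {v. {y, v} \<in> G}))"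
      using card_neighbours[OF G] by (intro card_mono) auto
    also have "\<dots> = (\<Sum>y\<in>insert x {y. {x, y} \<in> G}. vertex_degree G y)"
      using card_neighbours[OF G] by (subst card_SigmaI) auto
    also have "\<dots> \<le> card (insert x {y. {x, y} \<in> G}) * \<Delta>"
      by (rule order_trans[OF sum_bounded_above[where K = \<Delta>]]) (simp_all add: Dall)
    also have "card (insert x {y. {x, y} \<in> G}) \<le> \<Delta> + 1"
      using card_insert_le_m1 card_neighbours[OF G, of x] Dall[of x]
      by (metis Suc_eq_plus1 Suc_le_mono card_insert_if le_SucI)
    finally show ?thesis by (simp add: algebra_simps)
  qed
  have bad2: "card (bad2 x) \<le> \<Delta> * (\<Delta> + 1)" for x
  proof -
    \<comment> \<open>Arcs come in opposite pairs, so reversal turns one kind of spoiled arc into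
      the other.\<close>
    have "bad2 x = prod.swap ` bad1 x"
      by (auto simp: bad1_def bad2_def arcs_def insert_commute image_iff)
    then have "card (bad2 x) = card (bad1 x)" by (simp add: card_image)
    then show ?thesis using bad1 by simp
  qed
  let ?f = "\<lambda>((x, u), (y, v)). ((x :: nat, y :: nat), (u :: nat, v :: nat))"
  let ?D = "Sigma (X j \<times> X k) (\<lambda>(x, u). arcs ?R - (bad1 x \<union> bad2 u))"
  have "inj_on ?f ?D" by (auto simp: inj_on_def)
  have finX: "finite (X v)" "card (X v) = vertex_degree ?R v" for v
    unfolding X_def using card_neighbours[OF R] by auto
  have sub: "?f ` ?D \<subseteq> switches j k H G"
    by (auto simp: switches_def X_def bad1_def bad2_def arcs_def)
  have "switches j k H G \<subseteq> ({1..n} \<times> {1..n}) \<times> ({1..n} \<times> {1..n})"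
    using G by (auto simp: switches_def)
  then have "finite (switches j k H G)" by (rule finite_subset) simp
  then have "card (?f ` ?D) \<le> card (switches j k H G)" using sub by (intro card_mono)
  also have "card (?f ` ?D) = card ?D" using \<open>inj_on ?f ?D\<close> by (rule card_image)
  also have "card ?D = (\<Sum>(x, u)\<in>X j \<times> X k. card (arcs ?R - (bad1 x \<union> bad2 u)))"
    using finX card_arcs[OF R] by (subst card_SigmaI) (auto simp: case_prod_unfold)
  finally have "(\<Sum>(x, u)\<in>X j \<times> X k. card (arcs ?R - (bad1 x \<union> bad2 u))) \<le> card (switches j k H G)" .
  moreover have "(\<Sum>(x, u)\<in>X j \<times> X k. card (arcs ?R - (bad1 x \<union> bad2 u))) \<ge> (\<Sum>(x, u)\<in>X j \<times> X k. 2 * card ?R - 2 * (\<Delta> * (\<Delta> + 1)))"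
  proof (rule sum_mono, clarify)
    fix x u
    have "card (bad1 x \<union> bad2 u) \<le> 2 * (\<Delta> * (\<Delta> + 1))"
      using card_Un_le[of "bad1 x" "bad2 u"] bad1[of x] bad2[of u] by linarith
    moreover have "card (arcs ?R) - card (bad1 x \<union> bad2 u) \<le> card (arcs ?R - (bad1 x \<union> bad2 u))"
      by (intro diff_card_le_card_Diff finite_subset[OF _ card_arcs(1)[OF R]]) (auto simp: bad1_def bad2_def)
    ultimately show "2 * card ?R - 2 * (\<Delta> * (\<Delta> + 1)) \<le> card (arcs ?R - (bad1 x \<union> bad2 u))"
      using card_arcs(2)[OF R] by linarith
  qed
  ultimately show ?thesis using finX by (simp add: card_cartesian_product case_prod_unfold)
qed

definition switch :: "nat \<Rightarrow> nat \<Rightarrow> edge_set \<Rightarrow> (nat \<times> nat) \<times> (nat \<times> nat) \<Rightarrow> edge_set" where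
  "switch j k G = (\<lambda>((x, y), (u, v)). (G - {{j, x}, {k, u}, {y, v}}) \<union> {{j, k}, {x, y}, {u, v}})"

lemma switch_props:
  assumes G: "G \<in> graphs_with_degrees n d" and jk: "j \<noteq> k" "j \<in> {1..n}" "k \<in> {1..n}" "{j, k} \<notin> G"
    and z: "z = ((x, y), (u, v))" "z \<in> switches j k H G" and H: "H \<subseteq> G"
  shows "switch j k G z \<in> graphs_with_degrees n d" "H \<subseteq> switch j k G z" "{j, k} \<in> switch j k G z"
    "(x, y) \<in> arcs (switch j k G z - H)" "(u, v) \<in> arcs (switch j k G z - H)"
    "G = (switch j k G z - {{j, k}, {x, y}, {u, v}}) \<union> {{j, x}, {k, u}, {y, v}}"
proof -
  have GE: "G \<subseteq> all_edges n" and deg: "\<And>i. i \<in> {1..n} \<Longrightarrow> vertex_degree G i = d i"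
    using G by (auto simp: graphs_with_degrees_def)
  have finG: "finite G" using GE finite_all_edges finite_subset by blast
  let ?Rm = "{{j, x}, {k, u}, {y, v}}" and ?Ad = "{{j, k}, {x, y}, {u, v}}"
  have w: "{j, x} \<in> G" "{j, x} \<notin> H" "{k, u} \<in> G" "{k, u} \<notin> H" "{y, v} \<in> G" "{y, v} \<notin> H"
    "x \<noteq> y" "{x, y} \<notin> G" "u \<noteq> v" "{u, v} \<notin> G"
    using z by (auto simp: switches_def)
  have "{j, x} \<in> all_edges n" "{k, u} \<in> all_edges n" "{y, v} \<in> all_edges n" 
    by (rule subsetD[OF GE], rule w)+
  then have E: "j \<noteq> x" "k \<noteq> u" "y \<noteq> v" "{x, y, u, v} \<subseteq> {1..n}" by simp_all
  have sw: "switch j k G z = (G - ?Rm) \<union> ?Ad" by (simp add: switch_def z)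
  have sym: "{b, a} = {a, b}" for a b :: nat by auto
  \<comment> \<open>Coincidences contradict the non-edges: \<open>{j, x} = {k, u}\<close> would put
    \<open>{j, k}\<close> into \<open>G\<close>, while \<open>{j, x} = {y, v}\<close> would force
    \<open>y = j\<close>, since \<open>x \<noteq> y\<close>, and so put \<open>{x, y}\<close> into
    \<open>G\<close>.\<close>
  have dRm: "{j, x} \<noteq> {k, u}" "{j, x} \<noteq> {y, v}" "{k, u} \<noteq> {y, v}"
    using w jk E by (auto simp: doubleton_eq_iff sym)
  have dAd: "{j, k} \<noteq> {x, y}" "{j, k} \<noteq> {u, v}" "{x, y} \<noteq> {u, v}"
    using w jk E by (auto simp: doubleton_eq_iff sym)
  have "vertex_degree ?Rm i = vertex_degree ?Ad i" for i
    using dRm dAd w jk E by (simp add: vertex_degree_insert)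
  then have "vertex_degree (switch j k G z) i = vertex_degree G i" for i
    unfolding sw using w jk finG by (intro vertex_degree_exchange) auto
  moreover have "switch j k G z \<subseteq> all_edges n" using GE jk E w by (auto simp: sw)
  ultimately show "switch j k G z \<in> graphs_with_degrees n d" using deg by (simp add: graphs_with_degrees_def)
  show "H \<subseteq> switch j k G z" using H w by (auto simp: sw)
  show "{j, k} \<in> switch j k G z" by (simp add: sw)
  show "(x, y) \<in> arcs (switch j k G z - H)" "(u, v) \<in> arcs (switch j k G z - H)"
    using w H by (auto simp: sw arcs_def)
  show "G = (switch j k G z - ?Ad) \<union> ?Rm" unfolding sw using w jk by auto
qed

text \<open>
  The switching removes \<open>jx\<close>, \<open>ku\<close>, \<open>yv\<close> and inserts \<open>jk\<close>, \<open>xy\<close>, \<open>uv\<close>; together with the arcs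
  \<open>(x, y)\<close> and \<open>(u, v)\<close> the result determines the original graph.
\<close>
lemma switching_count:
  fixes H :: edge_set
  assumes deg: "\<And>i. i \<in> {1..n} \<Longrightarrow> d i \<le> \<Delta>" and m: "degree_sum n d = 2 * m"
    and jk: "j \<noteq> k" "j \<in> {1..n}" "k \<in> {1..n}"
  defines "\<A> \<equiv> {G \<in> graphs_with_degrees n d. H \<subseteq> G}"
  shows "card {G \<in> \<A>. {j, k} \<notin> G} * ((d j - vertex_degree H j) * (d k - vertex_degree H k) *
      (2 * (m - card H) - 2 * (\<Delta> * (\<Delta> + 1)))) \<le> card {G \<in> \<A>. {j, k} \<in> G} * (2 * (m - card H))\<^sup>2"
proof -
  let ?B = "{G \<in> \<A>. {j, k} \<notin> G}" and ?A = "{G \<in> \<A>. {j, k} \<in> G}"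
  have finA: "finite \<A>" unfolding \<A>_def using finite_graphs_with_degrees by simp
  have GE: "G \<subseteq> all_edges n" "finite G" "\<And>i. i \<in> {1..n} \<Longrightarrow> vertex_degree G i = d i" "card G = m" "H \<subseteq> G"
    if "G \<in> \<A>" for G
  proof -
    show GE: "G \<subseteq> all_edges n" "\<And>i. i \<in> {1..n} \<Longrightarrow> vertex_degree G i = d i" "H \<subseteq> G"
      using that by (auto simp: \<A>_def graphs_with_degrees_def)
    then show "finite G" using finite_all_edges finite_subset by blast
    have "2 * m = 2 * card G" unfolding m[symmetric] handshake[OF GE(1), symmetric] degree_sum_def
      using GE by simp
    then show "card G = m" by simp
  qed
  have cR: "card (G - H) = m - card H" if "G \<in> \<A>" for G
    using GE[OF that] by (simp add: card_Diff_subset finite_subset)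
  have dR: "vertex_degree (G - H) i = d i - vertex_degree H i" if "G \<in> \<A>" "i \<in> {1..n}" for G i
  proof -
    have "{e \<in> G - H. i \<in> e} = {e \<in> G. i \<in> e} - {e \<in> H. i \<in> e}" by auto
    moreover have "finite {e \<in> H. i \<in> e}" using GE[OF that(1)] finite_subset by fastforce
    moreover have "{e \<in> H. i \<in> e} \<subseteq> {e \<in> G. i \<in> e}" using GE[OF that(1)] by auto
    ultimately show ?thesis using GE(3)[OF that] by (simp add: vertex_degree_def card_Diff_subset)
  qed
  \<comment> \<open>Double counting: a graph without \<open>jk\<close> and a switch for it are sent
    injectively to a graph with \<open>jk\<close> and two residual arcs. Each graph with
    \<open>jk\<close> has \<open>(2 * (m - card H))\<^sup>2\<close> such pairs of arcs.\<close>
  let ?D = "Sigma ?B (switches j k H)" and ?f = "\<lambda>(G, z). (switch j k G z, z)"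
  let ?T = "Sigma ?A (\<lambda>G. arcs (G - H) \<times> arcs (G - H))"
  have fT: "finite (arcs (G - H))" "card (arcs (G - H)) = 2 * (m - card H)" if "G \<in> \<A>" for G
    using card_arcs[of "G - H" n] GE(1)[OF that] cR[OF that] by auto
  have img: "?f ` ?D \<subseteq> ?T"
  proof safe
    fix G x y u v assume "G \<in> \<A>" "{j, k} \<notin> G" "((x, y), (u, v)) \<in> switches j k H G"
    moreover from this have "G \<in> graphs_with_degrees n d" "H \<subseteq> G" by (auto simp: \<A>_def)
    ultimately have "switch j k G ((x, y), (u, v)) \<in> \<A>" "{j, k} \<in> switch j k G ((x, y), (u, v))"
      "(x, y) \<in> arcs (switch j k G ((x, y), (u, v)) - H)" "(u, v) \<in> arcs (switch j k G ((x, y), (u, v)) - H)"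
      using switch_props[of G n d j k _ x y u v H] jk by (auto simp: \<A>_def)
    then show "switch j k G ((x, y), (u, v)) \<in> \<A>" "{j, k} \<in> switch j k G ((x, y), (u, v))"
      "(x, y) \<in> arcs (switch j k G ((x, y), (u, v)) - H)" "(u, v) \<in> arcs (switch j k G ((x, y), (u, v)) - H)" .
  qed
  have inj: "inj_on ?f ?D"
  proof (rule inj_onI)
    fix p q assume pq: "p \<in> ?D" "q \<in> ?D" "?f p = ?f q"
    obtain G x y u v where p: "p = (G, ((x, y), (u, v)))" by (metis surj_pair)
    with pq(3) obtain G' where q: "q = (G', ((x, y), (u, v)))"
      and eq: "switch j k G ((x, y), (u, v)) = switch j k G' ((x, y), (u, v))" by (cases q) auto
    have "G = (switch j k G ((x, y), (u, v)) - {{j, k}, {x, y}, {u, v}}) \<union> {{j, x}, {k, u}, {y, v}}"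
      using pq(1) p jk by (intro switch_props(6)[of G n d j k _ x y u v H]) (auto simp: \<A>_def)
    moreover have "G' = (switch j k G' ((x, y), (u, v)) - {{j, k}, {x, y}, {u, v}}) \<union> {{j, x}, {k, u}, {y, v}}"
      using pq(2) q jk by (intro switch_props(6)[of G' n d j k _ x y u v H]) (auto simp: \<A>_def)
    ultimately show "p = q" using eq p q by simp
  qed
  have "card ?B * ((d j - vertex_degree H j) * (d k - vertex_degree H k) *
      (2 * (m - card H) - 2 * (\<Delta> * (\<Delta> + 1)))) \<le> (\<Sum>G\<in>?B. card (switches j k H G))"
  proof -
    have "(d j - vertex_degree H j) * (d k - vertex_degree H k) *
      (2 * (m - card H) - 2 * (\<Delta> * (\<Delta> + 1))) \<le> card (switches j k H G)" if G: "G \<in> ?B" for G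
      using card_switches_ge[of G n \<Delta> H j k] GE[of G] G deg jk by (simp add: dR cR)
    then show ?thesis using sum_mono[of ?B "\<lambda>_. (d j - vertex_degree H j) * (d k - vertex_degree H k) *
      (2 * (m - card H) - 2 * (\<Delta> * (\<Delta> + 1)))"] by simp
  qed
  also have "\<dots> = card ?D"
  proof (rule card_SigmaI[symmetric])
    show "\<forall>G\<in>?B. finite (switches j k H G)"
    proof
      fix G assume "G \<in> ?B"
      then have "switches j k H G \<subseteq> ({1..n} \<times> {1..n}) \<times> ({1..n} \<times> {1..n})"
        using GE(1)[of G] by (auto simp: switches_def)
      then show "finite (switches j k H G)" by (rule finite_subset) simp
    qed
  qed (use finA in simp)
  also have "card ?D = card (?f ` ?D)" using inj by (simp only: card_image)
  also have "\<dots> \<le> card ?T" using img finA fT by (intro card_mono) auto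
  also have "card ?T = card ?A * (2 * (m - card H))\<^sup>2"
    using finA fT by (subst card_SigmaI) (auto simp: card_cartesian_product power2_eq_square)
  finally show ?thesis .
qed

section \<open>Numerical estimates\<close>

lemma ex_one_point_pmf:
  fixes w :: "'a \<Rightarrow> real"
  assumes E: "finite E" and w: "\<And>e. e \<in> E \<Longrightarrow> 0 \<le> w e" and le: "sum w E \<le> 1"
  obtains \<kappa> :: "'a set pmf" where "\<And>e. e \<in> E \<Longrightarrow> pmf \<kappa> {e} = w e" "pmf \<kappa> {} = 1 - sum w E"
    "\<And>Y. Y \<in> set_pmf \<kappa> \<Longrightarrow> Y = {} \<or> (\<exists>e\<in>E. Y = {e})"
proof -
  define f where "f = (\<lambda>Y. if Y = {} then 1 - sum w E else if Y \<in> (\<lambda>e. {e}) ` E then w (the_elem Y) else 0)"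
  have f0: "0 \<le> f Y" for Y using w le by (auto simp: f_def)
  have "(\<integral>\<^sup>+Y. ennreal (f Y) \<partial>count_space UNIV) = (\<Sum>Y\<in>insert {} ((\<lambda>e. {e}) ` E). ennreal (f Y))"
    using E by (intro nn_integral_count_space') (auto simp: f_def)
  also have "\<dots> = ennreal (\<Sum>Y\<in>insert {} ((\<lambda>e. {e}) ` E). f Y)"
    using f0 by (intro sum_ennreal) auto
  also have "(\<Sum>Y\<in>insert {} ((\<lambda>e. {e}) ` E). f Y) = 1"
    using E by (subst sum.insert) (auto simp: f_def sum.reindex)
  finally have one: "(\<integral>\<^sup>+Y. ennreal (f Y) \<partial>count_space UNIV) = 1" by simp
  have pmf: "pmf (embed_pmf f) Y = f Y" for Y
    using f0 one by (rule pmf_embed_pmf)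
  have "Y = {} \<or> (\<exists>e\<in>E. Y = {e})" if "Y \<in> set_pmf (embed_pmf f)" for Y
  proof -
    have "f Y \<noteq> 0" using that by (simp add: set_pmf_iff pmf)
    then show ?thesis by (auto simp: f_def split: if_splits)
  qed
  moreover have "pmf (embed_pmf f) {e} = w e" if "e \<in> E" for e
    using that unfolding pmf by (simp add: f_def)
  moreover have "pmf (embed_pmf f) {} = 1 - sum w E" unfolding pmf by (simp add: f_def)
  ultimately show thesis by (intro that[of "embed_pmf f"])
qed

lemma Min_Max_doubleton: "{Min e, Max e} = e" "Min e < Max e" "Min e \<in> {1..n}" "Max e \<in> {1..n}" if "e \<in> all_edges n"
proof -
  obtain j k where e: "e = {j, k}" "j \<in> {1..n}" "k \<in> {1..n}" "j \<noteq> k" using \<open>e \<in> all_edges n\<close> edgeE by blast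
  then show "{Min e, Max e} = e" "Min e < Max e" "Min e \<in> {1..n}" "Max e \<in> {1..n}"
    by (auto simp: min_def max_def)
qed

text \<open>The square of the degree sum counts every edge of the complete graph in both orders and
  the diagonal besides. This caps the total weight of a single draw.\<close>

lemma sum_edge_products_le:
  fixes d :: "nat \<Rightarrow> nat"
  shows "2 * (\<Sum>e\<in>all_edges n. d (Min e) * d (Max e)) \<le> (degree_sum n d)\<^sup>2"
proof -
  let ?A = "{(x, y). x \<in> {1..n} \<and> y \<in> {1..n} \<and> x < y}"
  let ?g = "\<lambda>(x, y). d x * d y"
  have sub: "?A \<subseteq> {1..n} \<times> {1..n}" by auto
  then have fA: "finite ?A" using finite_subset by blast
  have 1: "(\<Sum>e\<in>all_edges n. d (Min e) * d (Max e)) = sum ?g ?A"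
  proof (rule sum.reindex_bij_witness[of _ "\<lambda>(x, y). {x, y}" "\<lambda>e. (Min e, Max e)"])
    show "(\<lambda>(x, y). {x, y}) (Min e, Max e) = e" if "e \<in> all_edges n" for e
      using Min_Max_doubleton[OF that] by simp
    show "(Min e, Max e) \<in> ?A" if "e \<in> all_edges n" for e
      using Min_Max_doubleton[OF that] by simp
    show "(Min ((\<lambda>(x, y). {x, y}) z), Max ((\<lambda>(x, y). {x, y}) z)) = z" if "z \<in> ?A" for z
      using that by auto
  qed auto
  have "sum ?g (prod.swap ` ?A) = sum ?g ?A"
    by (subst sum.reindex) (auto simp: case_prod_unfold mult.commute)
  then have "2 * sum ?g ?A = sum ?g (?A \<union> prod.swap ` ?A)"
    using fA by (subst sum.union_disjoint) auto
  also have "\<dots> \<le> sum ?g ({1..n} \<times> {1..n})"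
    using sub by (intro sum_mono2) auto
  also have "\<dots> = (degree_sum n d)\<^sup>2"
    by (simp add: degree_sum_def power2_eq_square sum_product sum.cartesian_product)
  finally show ?thesis using 1 by simp
qed

text \<open>Chernoff exponent for a vertex of degree \<open>k\<close> when a fraction
  \<open>s\<close> of the edges is exposed. The threshold exceeds the mean \<open>k * s\<close> by
  \<open>\<alpha> * (1 - s) * k\<close>, which is at least \<open>\<alpha>\<^sup>2 * k\<close>. With
  tilt \<open>x\<close> the exponent per incident edge is at most
  \<open>x\<^sup>2 - \<alpha>\<^sup>2 * x\<close>; this is smallest at
  \<open>x = \<alpha>\<^sup>2 / 2\<close>, where it equals
  \<open>- (\<alpha> ^ 4 / 4)\<close>.\<close>

lemma exponent_bound:
  fixes s \<alpha> x :: real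
  assumes "0 \<le> s" "\<alpha> \<le> 1 - s" "0 < \<alpha>" "\<alpha> \<le> 1"
  shows "(1 + \<alpha>\<^sup>2 / 2 * s) ^ k * (1 + \<alpha>\<^sup>2 / 2) powr (- (k * (s + \<alpha> * (1 - s)))) \<le> exp (- (\<alpha> ^ 4 * k / 4))"
proof -
  define x where "x = \<alpha>\<^sup>2 / 2"
  define c where "c = s + \<alpha> * (1 - s)"
  have "\<alpha>\<^sup>2 \<le> 1" using assms by (simp add: power_le_one)
  then have x: "0 < x" "x \<le> 1" using assms by (auto simp: x_def)
  have c: "0 \<le> c" "c \<le> 1"
  proof -
    show "0 \<le> c" using assms by (simp add: c_def)
    have "\<alpha> * (1 - s) \<le> 1 * (1 - s)" using assms by (intro mult_right_mono) auto
    then show "c \<le> 1" by (simp add: c_def)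
  qed
  have "x - x\<^sup>2 \<le> ln (1 + x)" using ln_one_plus_pos_lower_bound[of x] x by simp
  then have "c * (x - x\<^sup>2) \<le> c * ln (1 + x)" using c by (intro mult_left_mono)
  moreover have "c * x\<^sup>2 \<le> x\<^sup>2" using c by (simp add: mult_left_le_one_le)
  moreover have "\<alpha> * \<alpha> * x \<le> \<alpha> * (1 - s) * x" using assms x by (intro mult_right_mono mult_left_mono) auto
  moreover have "\<alpha> * \<alpha> * x = 2 * x\<^sup>2" "x\<^sup>2 = \<alpha> ^ 4 / 4"
    by (simp_all add: x_def power2_eq_square power4_eq_xxxx)
  moreover have "c * (x - x\<^sup>2) = s * x + \<alpha> * (1 - s) * x - c * x\<^sup>2" by (simp add: c_def algebra_simps)
  ultimately have key: "x * s - c * ln (1 + x) \<le> - (\<alpha> ^ 4 / 4)" by (simp add: algebra_simps)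
  have "(1 + x * s) ^ k \<le> exp (x * s) ^ k"
    using x assms by (intro power_mono) auto
  also have "\<dots> = exp (k * (x * s))" by (simp add: exp_of_nat_mult)
  finally have "(1 + x * s) ^ k * (1 + x) powr (- (k * c)) \<le> exp (k * (x * s)) * exp (- (k * c) * ln (1 + x))"
    using x by (simp add: powr_def mult_right_mono)
  also have "\<dots> = exp (k * (x * s - c * ln (1 + x)))" by (simp add: exp_add[symmetric] algebra_simps)
  also have "\<dots> \<le> exp (k * (- (\<alpha> ^ 4 / 4)))" using key by (simp only: exp_le_cancel_iff) (intro mult_left_mono; simp)
  also have "k * (- (\<alpha> ^ 4 / 4)) = - (\<alpha> ^ 4 * k / 4)" by simp
  finally show ?thesis by (simp add: x_def c_def)
qed

text \<open>Mean \<open>(1 - 2 * \<alpha>) * m\<close> against threshold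
  \<open>(1 - \<alpha>) * m\<close>: with tilt \<open>y\<close> the exponent is at most
  \<open>m * (y\<^sup>2 - \<alpha> * y)\<close>, smallest at
  \<open>y = \<alpha> / 2\<close>.\<close>

lemma poisson_exponent_bound:
  fixes \<alpha> m :: real
  assumes "0 < \<alpha>" "\<alpha> \<le> 1" "0 \<le> m"
  shows "exp ((1 - 2 * \<alpha>) * m * ((1 + \<alpha> / 2) - 1)) * (1 + \<alpha> / 2) powr (- ((1 - \<alpha>) * m)) \<le> exp (- (\<alpha>\<^sup>2 * m / 4))"
proof -
  define y where "y = \<alpha> / 2"
  have y: "0 < y" "y \<le> 1" using assms by (auto simp: y_def)
  have "y - y\<^sup>2 \<le> ln (1 + y)" using ln_one_plus_pos_lower_bound[of y] y by simp
  then have "(1 - \<alpha>) * (y - y\<^sup>2) \<le> (1 - \<alpha>) * ln (1 + y)" using assms by (intro mult_left_mono) auto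
  moreover have "(1 - \<alpha>) * (y - y\<^sup>2) = (1 - 2 * \<alpha>) * y + \<alpha> * y\<^sup>2 + \<alpha>\<^sup>2 / 4"
    by (simp add: y_def power2_eq_square field_simps)
  moreover have "0 \<le> \<alpha> * y\<^sup>2" using assms by simp
  ultimately have key: "(1 - 2 * \<alpha>) * y - (1 - \<alpha>) * ln (1 + y) \<le> - (\<alpha>\<^sup>2 / 4)"
    by simp
  have "exp ((1 - 2 * \<alpha>) * m * y) * (1 + y) powr (- ((1 - \<alpha>) * m))
      = exp (m * ((1 - 2 * \<alpha>) * y - (1 - \<alpha>) * ln (1 + y)))"
    using y by (simp add: powr_def exp_add[symmetric] algebra_simps)
  also have "\<dots> \<le> exp (m * (- (\<alpha>\<^sup>2 / 4)))"
    using key assms by (simp only: exp_le_cancel_iff) (intro mult_left_mono; simp)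
  finally show ?thesis by (simp add: y_def mult.commute)
qed

text \<open>Here \<open>a\<close> and \<open>b\<close> count the graphs with and without
  \<open>jk\<close>, \<open>s\<close> is the number of unexposed edges, and \<open>rj\<close>,
  \<open>rk\<close> are residual degrees. Switching gives \<open>b * u \<le> a\<close> for the
  \<open>u\<close> of the proof, and \<open>u \<le> \<alpha>\<close>. Four factors
  \<open>1 - \<alpha>\<close> are lost: one to the term \<open>4 * \<Delta>\<^sup>2\<close>, one in
  passing from \<open>u\<close> to \<open>u / (1 + u)\<close>, two to the residual degrees. The
  powers of \<open>s\<close> cancel, so the bound is the same at all times, which is what allows
  identically distributed draws.\<close>

lemma switching_ratio_bound:
  fixes a b m t rj rk dj dk \<alpha> \<Delta> :: real
  assumes \<alpha>: "0 < \<alpha>" "\<alpha> \<le> 1 / 4" and ab: "0 \<le> a" "0 \<le> b" "0 < a + b"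
    and s: "0 < m" "\<alpha> * m \<le> s" "s \<le> m" and \<Delta>: "2 * \<Delta>\<^sup>2 \<le> \<alpha>\<^sup>2 * m"
    and r: "(1 - \<alpha>) * (s / m) * dj \<le> rj" "(1 - \<alpha>) * (s / m) * dk \<le> rk" "0 \<le> dj" "0 \<le> dk" "rj \<le> \<Delta>" "rk \<le> \<Delta>"
    and sw: "b * (rj * rk * (2 * s - 4 * \<Delta>\<^sup>2)) \<le> a * (2 * s)\<^sup>2"
  shows "(1 - 4 * \<alpha>) * (dj * dk / (2 * m\<^sup>2)) \<le> a / (a + b) / s"
proof -
  have s0: "0 < s" using \<alpha> s by (meson mult_pos_pos order_less_le_trans)
  have r0: "0 \<le> rj" "0 \<le> rk" using r \<alpha> s s0 by (auto intro!: order_trans[OF _ r(1)] order_trans[OF _ r(2)])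
  define u where "u = (1 - \<alpha>) * (rj * rk) / (2 * s)"
  have u0: "0 \<le> u" using \<alpha> r0 s0 by (simp add: u_def)
  \<comment> \<open>Since \<open>s\<close> is at least \<open>\<alpha> * m\<close>, the bound on
    \<open>\<Delta>\<^sup>2\<close> in terms of \<open>m\<close> also holds in terms of
    \<open>s\<close>, with one factor \<alpha> less.\<close>
  have am: "\<alpha>\<^sup>2 * m \<le> \<alpha> * s" using s \<alpha> by (simp add: power2_eq_square)
  have "rj * rk \<le> \<Delta>\<^sup>2" using r r0 by (simp add: power2_eq_square mult_mono')
  then have "rj * rk \<le> \<alpha> * s" using am \<Delta> zero_le_power2[of \<Delta>] by linarith
  moreover have "(1 - \<alpha>) * (rj * rk) \<le> 1 * (rj * rk)" using \<alpha> r0 by (intro mult_right_mono) auto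
  ultimately have "(1 - \<alpha>) * (rj * rk) \<le> \<alpha> * (2 * s)" using mult_pos_pos[OF \<alpha>(1) s0] by simp
  then have u\<alpha>: "u \<le> \<alpha>" using s0 by (simp add: u_def field_simps)
  have "b * u \<le> a"
  proof -
    have "(1 - \<alpha>) * (2 * s) \<le> 2 * s - 4 * \<Delta>\<^sup>2" using am \<Delta> by (simp add: algebra_simps)
    then have "b * (rj * rk * ((1 - \<alpha>) * (2 * s))) \<le> b * (rj * rk * (2 * s - 4 * \<Delta>\<^sup>2))"
      using ab r0 by (intro mult_left_mono) auto
    moreover have "b * u * (2 * s)\<^sup>2 = b * (rj * rk * ((1 - \<alpha>) * (2 * s)))"
      using s0 by (simp add: u_def power2_eq_square)
    ultimately have "b * u * (2 * s)\<^sup>2 \<le> a * (2 * s)\<^sup>2" using sw by linarith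
    then show ?thesis using s0 by simp
  qed
  then have "u * (a + b) \<le> a * (1 + u)" by (simp add: algebra_simps)
  moreover have "(1 - \<alpha>) * (1 + u) \<le> 1"
  proof -
    have "(1 - \<alpha>) * (1 + u) = 1 + u - \<alpha> - \<alpha> * u" by (simp add: algebra_simps)
    moreover have "0 \<le> \<alpha> * u" using \<alpha> u0 by simp
    ultimately show ?thesis using u\<alpha> by simp
  qed
  ultimately have "(1 - \<alpha>) * (u * (a + b)) \<le> a"
  proof -
    assume 1: "u * (a + b) \<le> a * (1 + u)" and 2: "(1 - \<alpha>) * (1 + u) \<le> 1"
    have "(1 - \<alpha>) * (u * (a + b)) \<le> (1 - \<alpha>) * (a * (1 + u))" using 1 \<alpha> by (intro mult_left_mono) auto
    also have "\<dots> = a * ((1 - \<alpha>) * (1 + u))" by (simp add: algebra_simps)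
    also have "\<dots> \<le> a" using 2 ab by (simp add: mult_left_le)
    finally show ?thesis .
  qed
  then have "(1 - \<alpha>) * u \<le> a / (a + b)" using ab by (simp add: field_simps)
  moreover have "(1 - \<alpha>) ^ 3 * (s / m)\<^sup>2 * (dj * dk) / (2 * s) \<le> u"
  proof -
    have "((1 - \<alpha>) * (s / m) * dj) * ((1 - \<alpha>) * (s / m) * dk) \<le> rj * rk"
      using r r0 \<alpha> s s0 by (intro mult_mono) auto
    then have "(1 - \<alpha>) * (((1 - \<alpha>) * (s / m) * dj) * ((1 - \<alpha>) * (s / m) * dk)) \<le> (1 - \<alpha>) * (rj * rk)"
      using \<alpha> by (intro mult_left_mono) auto
    then show ?thesis using s0 unfolding u_def
      by (intro divide_right_mono) (auto simp: power2_eq_square power3_eq_cube mult_ac)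
  qed
  ultimately have "(1 - \<alpha>) * ((1 - \<alpha>) ^ 3 * (s / m)\<^sup>2 * (dj * dk) / (2 * s)) \<le> a / (a + b)"
    using \<alpha> by (elim order_trans[rotated] mult_left_mono) simp
  then have "(1 - \<alpha>) * ((1 - \<alpha>) ^ 3 * (s / m)\<^sup>2 * (dj * dk) / (2 * s)) / s \<le> a / (a + b) / s"
    using s0 by (intro divide_right_mono) auto
  moreover have "(1 - \<alpha>) * ((1 - \<alpha>) ^ 3 * (s / m)\<^sup>2 * (dj * dk) / (2 * s)) / s = (1 - \<alpha>) ^ 4 * (dj * dk / (2 * m\<^sup>2))"
    using s0 s by (simp add: field_simps power2_eq_square power3_eq_cube power4_eq_xxxx)
  moreover have "(1 - 4 * \<alpha>) * (dj * dk / (2 * m\<^sup>2)) \<le> (1 - \<alpha>) ^ 4 * (dj * dk / (2 * m\<^sup>2))"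
    using Bernoulli_inequality[of "- \<alpha>" 4] \<alpha> r by (intro mult_right_mono) auto
  ultimately show ?thesis by linarith
qed

section \<open>The embedding for a fixed precision\<close>

lemma (in uniform_family) measure_\<mu>_le:
  assumes "\<And>G. G \<in> \<F> \<Longrightarrow> measure_pmf.prob (random_subset t G) B \<le> \<beta>"
  shows "measure_pmf.prob (\<mu> t) B \<le> \<beta>"
proof -
  have "measure_pmf.prob (\<mu> t) B = (\<integral>G. measure_pmf.prob (random_subset t G) B \<partial>measure_pmf (pmf_of_set \<F>))"
    unfolding \<mu>_def by (rule measure_bind_pmf)
  also have "\<dots> = (\<Sum>G\<in>\<F>. measure_pmf.prob (random_subset t G) B) / card \<F>"
    using fin ne by (simp add: integral_pmf_of_set)
  also have "\<dots> \<le> (\<Sum>G\<in>\<F>. \<beta>) / card \<F>"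
    using assms by (intro divide_right_mono sum_mono) auto
  also have "\<dots> = \<beta>" using fin ne by simp
  finally show ?thesis .
qed

text \<open>A residual degree is too small only if \<open>H\<close> has taken at least
  \<open>d i * (s + \<alpha> * (1 - s))\<close> of the edges at \<open>i\<close>, where
  \<open>s = t / m\<close>. This is an upper tail event for a random \<open>t\<close>-subset of
  \<open>G\<close>; a union bound over the vertices finishes.\<close>

lemma random_subset_degree_tail:
  fixes \<alpha> \<delta> :: real
  assumes G: "G \<in> graphs_with_degrees n d" "card G = m" and \<alpha>: "0 < \<alpha>" "\<alpha> \<le> 1" and m: "0 < m"
    and t: "real t \<le> (1 - \<alpha>) * m" and \<delta>: "\<And>i. i \<in> {1..n} \<Longrightarrow> \<delta> \<le> d i"
  shows "measure_pmf.prob (random_subset t G)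
      {H. \<exists>i\<in>{1..n}. real (d i - vertex_degree H i) < (1 - \<alpha>) * (real (m - t) / m) * d i}
    \<le> n * exp (- (\<alpha> ^ 4 * \<delta> / 4))"
proof -
  define s where "s = real t / real m"
  have fG: "finite G" using G finite_all_edges finite_subset by (auto simp: graphs_with_degrees_def)
  have s: "0 \<le> s" "\<alpha> \<le> 1 - s" using t m by (auto simp: s_def field_simps)
  have "0 \<le> \<alpha> * m" using \<alpha> by simp
  then have tm: "t \<le> m" using t by (simp add: algebra_simps)
  have ms: "real (m - t) / m = 1 - s" using tm m by (simp add: s_def of_nat_diff field_simps)
  let ?B = "\<lambda>i. {H. d i * (s + \<alpha> * (1 - s)) \<le> card (H \<inter> {e \<in> G. i \<in> e})}"
  have "measure_pmf.prob (random_subset t G)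
      {H. \<exists>i\<in>{1..n}. real (d i - vertex_degree H i) < (1 - \<alpha>) * (real (m - t) / m) * d i}
      \<le> measure_pmf.prob (random_subset t G) (\<Union>i\<in>{1..n}. ?B i)"
  proof (rule measure_pmf.finite_measure_mono_AE)
    show "AE H in random_subset t G. H \<in> {H. \<exists>i\<in>{1..n}. real (d i - vertex_degree H i) < (1 - \<alpha>) * (real (m - t) / m) * d i}
      \<longrightarrow> H \<in> (\<Union>i\<in>{1..n}. ?B i)"
      unfolding AE_measure_pmf_iff
    proof (intro ballI impI)
      fix H assume "H \<in> set_pmf (random_subset t G)"
      then have "H \<subseteq> G" using set_random_subset[OF fG, of t] tm G by simp
      then have eq: "H \<inter> {e \<in> G. i \<in> e} = {e \<in> H. i \<in> e}" for i by auto
      assume "H \<in> {H. \<exists>i\<in>{1..n}. real (d i - vertex_degree H i) < (1 - \<alpha>) * (real (m - t) / m) * d i}"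
      then obtain i where i: "i \<in> {1..n}" "real (d i - vertex_degree H i) < (1 - \<alpha>) * (1 - s) * d i"
        unfolding ms by auto
      \<comment> \<open>Subtraction on naturals is truncated, so it is never below the real
        difference and the upper bound carries over.\<close>
      then have "real (d i) - vertex_degree H i < (1 - \<alpha>) * (1 - s) * d i" by linarith
      then have "d i * (s + \<alpha> * (1 - s)) \<le> vertex_degree H i" by (simp add: algebra_simps)
      then have "H \<in> ?B i" unfolding mem_Collect_eq eq vertex_degree_def .
      then show "H \<in> (\<Union>i\<in>{1..n}. ?B i)" using i by blast
    qed
  qed simp
  also have "\<dots> \<le> (\<Sum>i\<in>{1..n}. measure_pmf.prob (random_subset t G) (?B i))"
    by (rule measure_pmf.finite_measure_subadditive_finite) auto
  also have "\<dots> \<le> (\<Sum>i\<in>{1..n}. exp (- (\<alpha> ^ 4 * \<delta> / 4)))"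
  proof (rule sum_mono)
    fix i assume i: "i \<in> {1..n}"
    have di: "card {e \<in> G. i \<in> e} = d i" using G i by (auto simp: graphs_with_degrees_def vertex_degree_def)
    have "measure_pmf.prob (random_subset t G) (?B i) \<le>
        (1 + \<alpha>\<^sup>2 / 2 * (real t / real (card G))) ^ card {e \<in> G. i \<in> e} * (1 + \<alpha>\<^sup>2 / 2) powr (- (d i * (s + \<alpha> * (1 - s))))"
      using fG tm G by (intro random_subset_upper_tail) auto
    also have "\<dots> \<le> exp (- (\<alpha> ^ 4 * d i / 4))"
      using exponent_bound[OF s \<alpha>, of "d i"] unfolding di G(2) s_def[symmetric] .
    also have "\<dots> \<le> exp (- (\<alpha> ^ 4 * \<delta> / 4))"
      using \<delta>[OF i] \<alpha> by (simp add: mult_left_mono)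
    finally show "measure_pmf.prob (random_subset t G) (?B i) \<le> exp (- (\<alpha> ^ 4 * \<delta> / 4))" .
  qed
  also have "\<dots> = n * exp (- (\<alpha> ^ 4 * \<delta> / 4))" by simp
  finally show ?thesis .
qed

lemma edge_probability_lower_bound:
  fixes H :: edge_set and \<alpha> :: real
  assumes \<alpha>: "0 < \<alpha>" "\<alpha> \<le> 1 / 4"
    and \<Delta>: "\<And>i. i \<in> {1..n} \<Longrightarrow> d i \<le> \<Delta>" "4 * (real \<Delta>)\<^sup>2 \<le> \<alpha>\<^sup>2 * degree_sum n d" "1 \<le> \<Delta>"
    and m: "degree_sum n d = 2 * m" "0 < m"
    and H: "{G \<in> graphs_with_degrees n d. H \<subseteq> G} \<noteq> {}" "card H = t" "real t \<le> (1 - \<alpha>) * m"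
    and r: "\<And>i. i \<in> {1..n} \<Longrightarrow> (1 - \<alpha>) * (real (m - t) / m) * d i \<le> real (d i - vertex_degree H i)"
    and jk: "j \<noteq> k" "j \<in> {1..n}" "k \<in> {1..n}"
  shows "(1 - 4 * \<alpha>) * (real (d j) * real (d k) / (2 * (real m)\<^sup>2)) \<le>
    real (card {G \<in> {G \<in> graphs_with_degrees n d. H \<subseteq> G}. {j, k} \<in> G}) /
    real (card {G \<in> graphs_with_degrees n d. H \<subseteq> G}) / real (m - t)"
proof -
  let ?A = "{G \<in> graphs_with_degrees n d. H \<subseteq> G}"
  let ?a = "card {G \<in> ?A. {j, k} \<in> G}" and ?b = "card {G \<in> ?A. {j, k} \<notin> G}"
  have fA: "finite ?A" using finite_graphs_with_degrees by simp
  have "card ?A = card ({G \<in> ?A. {j, k} \<in> G} \<union> {G \<in> ?A. {j, k} \<notin> G})"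
    by (rule arg_cong[of _ _ card]) auto
  also have "\<dots> = ?a + ?b"
    using finite_graphs_with_degrees[of n d] by (intro card_Un_disjoint) auto
  finally have ab: "card ?A = ?a + ?b" .
  have "card ?A > 0" using fA H by (simp add: card_gt_0_iff)
  have "0 \<le> \<alpha> * m" using \<alpha> by simp
  then have tm: "t \<le> m" using H by (simp add: algebra_simps)
  let ?rj = "d j - vertex_degree H j" and ?rk = "d k - vertex_degree H k"
  have "real (?b * (?rj * ?rk * (2 * (m - t) - 2 * (\<Delta> * (\<Delta> + 1))))) \<le> real (?a * (2 * (m - t))\<^sup>2)"
    using switching_count[OF \<Delta>(1) m(1) jk, of H] H(2) by (simp only: of_nat_le_iff)
  then have sw0: "real ?b * (real ?rj * real ?rk * real (2 * (m - t) - 2 * (\<Delta> * (\<Delta> + 1)))) \<le> real ?a * (2 * real (m - t))\<^sup>2"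
    by (simp only: of_nat_mult of_nat_power of_nat_numeral)
  \<comment> \<open>With \<open>\<Delta>\<close> at least 1 the number
    \<open>2 * (\<Delta> * (\<Delta> + 1))\<close> of spoiled arcs is at most the
    \<open>4 * \<Delta>\<^sup>2\<close> of the ratio bound.\<close>
  have "\<Delta> * (\<Delta> + 1) \<le> \<Delta> * (2 * \<Delta>)" using \<Delta>(3) by (intro mult_left_mono) auto
  then have "real (\<Delta> * (\<Delta> + 1)) \<le> real (\<Delta> * (2 * \<Delta>))" by (simp only: of_nat_le_iff)
  then have "2 * real (m - t) - 4 * (real \<Delta>)\<^sup>2 \<le> real (2 * (m - t)) - real (2 * (\<Delta> * (\<Delta> + 1)))"
    by (simp add: power2_eq_square)
  also have "\<dots> \<le> real (2 * (m - t) - 2 * (\<Delta> * (\<Delta> + 1)))" by linarith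
  finally have "real ?b * (real ?rj * real ?rk * (2 * real (m - t) - 4 * (real \<Delta>)\<^sup>2)) \<le> real ?a * (2 * real (m - t))\<^sup>2"
    by (intro order_trans[OF _ sw0] mult_left_mono) auto
  moreover have "real ?rj \<le> \<Delta>" "real ?rk \<le> \<Delta>" using \<Delta>(1)[OF jk(2)] \<Delta>(1)[OF jk(3)] by auto
  moreover have "2 * (real \<Delta>)\<^sup>2 \<le> \<alpha>\<^sup>2 * m" using \<Delta>(2) m by (simp add: mult.commute)
  moreover have "\<alpha> * m \<le> real (m - t)" using H(3) tm by (simp add: of_nat_diff algebra_simps)
  ultimately show ?thesis
    unfolding ab of_nat_add using \<alpha> m r jk \<open>card ?A > 0\<close> ab
    by (intro switching_ratio_bound[where \<Delta> = \<Delta>]) auto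
qed

text \<open>
  The probability that \<open>jk\<close> occurs among \<open>Poisson((1 - 2\<alpha>) m)\<close> draws of single edges in which it has
  probability \<open>(1 - 4\<alpha>) d\<^sub>j d\<^sub>k / (2 m\<^sup>2)\<close>, where \<open>degree_sum n d = 2 m\<close>.
\<close>
definition embedding_matrix :: "real \<Rightarrow> nat \<Rightarrow> (nat \<Rightarrow> nat) \<Rightarrow> nat \<Rightarrow> nat \<Rightarrow> real" where
  "embedding_matrix \<alpha> n d j k = (if j = k then 0
     else 1 - exp (- ((1 - 2 * \<alpha>) * (1 - 4 * \<alpha>) * (real (d j * d k) / degree_sum n d))))"

text \<open>Off the diagonal both matrices are functions of the \<open>x\<close> of the proof, which
  is at most \<alpha>: one is \<open>x / (1 + x)\<close>, the other
  \<open>1 - exp (- (c * x))\<close>. From above, the latter is at most \<open>c * x\<close>, and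
  \<open>c * (1 + x) \<le> (1 - \<alpha>) * (1 + \<alpha>) \<le> 1\<close>. From below, it is at
  least \<open>c * x / (1 + c * x)\<close>, hence at least \<open>c * x / (1 + x)\<close>, and
  \<open>c\<close> is at least \<open>1 - 6 * \<alpha>\<close>.\<close>

lemma embedding_matrix_bounds:
  fixes \<alpha> :: real
  assumes \<alpha>: "0 < \<alpha>" "\<alpha> \<le> 1 / 8" and jk: "j \<in> {1..n}" "k \<in> {1..n}"
    and \<Delta>: "\<And>i. i \<in> {1..n} \<Longrightarrow> d i \<le> \<Delta>" "4 * (real \<Delta>)\<^sup>2 \<le> \<alpha>\<^sup>2 * degree_sum n d" "0 < degree_sum n d"
  shows "0 \<le> embedding_matrix \<alpha> n d j k" "embedding_matrix \<alpha> n d j k \<le> 1" "embedding_matrix \<alpha> n d j k \<le> degree_matrix n d j k"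
    "(1 - 7 * \<alpha>) * degree_matrix n d j k \<le> embedding_matrix \<alpha> n d j k"
proof -
  define x where "x = real (d j * d k) / degree_sum n d"
  define c where "c = (1 - 2 * \<alpha>) * (1 - 4 * \<alpha>)"
  have c: "1 - 6 * \<alpha> \<le> c" "c \<le> 1 - \<alpha>" "0 \<le> c"
  proof -
    have "c = 1 - 6 * \<alpha> + 8 * \<alpha> * \<alpha>" by (simp add: c_def algebra_simps)
    moreover have "0 \<le> \<alpha> * \<alpha>" "\<alpha> * \<alpha> \<le> \<alpha> * (1 / 8)" using \<alpha> by (auto intro: mult_left_mono)
    ultimately show "1 - 6 * \<alpha> \<le> c" "c \<le> 1 - \<alpha>" "0 \<le> c" using \<alpha> by auto
  qed
  have x0: "0 \<le> x" by (simp add: x_def)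
  have "d j * d k \<le> \<Delta> * \<Delta>" using jk \<Delta>(1) by (intro mult_mono) auto
  then have "real (d j * d k) \<le> real (\<Delta> * \<Delta>)" by (simp only: of_nat_le_iff)
  moreover have "\<alpha>\<^sup>2 * degree_sum n d \<le> \<alpha> * degree_sum n d"
    using \<alpha> by (intro mult_right_mono) (auto simp: power2_eq_square mult_left_le)
  ultimately have "real (d j * d k) \<le> \<alpha> * degree_sum n d"
    using \<Delta>(2) zero_le_square[of "real \<Delta>"] unfolding of_nat_mult power2_eq_square by linarith
  then have x\<alpha>: "x \<le> \<alpha>" using \<Delta>(3) by (simp add: x_def field_simps)
  have P: "degree_matrix n d j k = (if j = k then 0 else x / (1 + x))"
    using \<Delta>(3) by (simp add: degree_matrix_def x_def field_simps)
  have W: "embedding_matrix \<alpha> n d j k = (if j = k then 0 else 1 - exp (- (c * x)))"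
    by (simp add: embedding_matrix_def x_def c_def)
  have cx: "0 \<le> c * x" using c x0 by simp
  show "0 \<le> embedding_matrix \<alpha> n d j k" "embedding_matrix \<alpha> n d j k \<le> 1" using cx by (auto simp: W)
  have "1 - exp (- (c * x)) \<le> c * x" using exp_ge_add_one_self[of "- (c * x)"] by simp
  also have "\<dots> \<le> x / (1 + x)"
  proof -
    have "c * (1 + x) \<le> (1 - \<alpha>) * (1 + \<alpha>)" using c x\<alpha> x0 \<alpha> by (intro mult_mono) auto
    also have "\<dots> \<le> 1" by (simp add: algebra_simps)
    finally have "c * (1 + x) * x \<le> 1 * x" using x0 by (intro mult_right_mono)
    then show ?thesis using x0 by (simp add: field_simps)
  qed
  finally show "embedding_matrix \<alpha> n d j k \<le> degree_matrix n d j k" by (simp add: W P)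
  have "(1 - 7 * \<alpha>) * (x / (1 + x)) \<le> 1 - exp (- (c * x))"
  proof -
    have e: "exp (- (c * x)) \<le> 1 / (1 + c * x)"
      using exp_ge_add_one_self[of "c * x"] cx by (simp add: exp_minus inverse_eq_divide field_simps)
    have "c * x \<le> 1 * x" using c x0 \<alpha> by (intro mult_right_mono) auto
    then have "c * x / (1 + x) \<le> c * x / (1 + c * x)"
      using cx x0 by (intro divide_left_mono mult_pos_pos) auto
    also have "\<dots> = 1 - 1 / (1 + c * x)" using cx by (simp add: field_simps)
    also have "\<dots> \<le> 1 - exp (- (c * x))" using e by simp
    finally have 1: "c * x / (1 + x) \<le> 1 - exp (- (c * x))" .
    have "(1 - 7 * \<alpha>) * (x / (1 + x)) \<le> c * (x / (1 + x))"
      using c \<alpha> x0 by (intro mult_right_mono) auto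
    then show ?thesis using 1 by simp
  qed
  then show "(1 - 7 * \<alpha>) * degree_matrix n d j k \<le> embedding_matrix \<alpha> n d j k" by (simp add: W P)
qed

text \<open>The first error term bounds the union over exposure steps and vertices of the events
  that a residual degree is too small. The second bounds the chance that the Poisson number of draws
  exceeds \<open>(1 - \<alpha>) * m\<close>.\<close>

lemma approx_dominated_random_graph:
  fixes \<alpha> \<delta> :: real
  assumes \<alpha>: "0 < \<alpha>" "\<alpha> \<le> 1 / 8" and d: "degree_sequence n d"
    and \<Delta>: "\<And>i. i \<in> {1..n} \<Longrightarrow> d i \<le> \<Delta>" "4 * (real \<Delta>)\<^sup>2 \<le> \<alpha>\<^sup>2 * degree_sum n d" "1 \<le> \<Delta>" "0 < degree_sum n d"
    and \<delta>: "\<And>i. i \<in> {1..n} \<Longrightarrow> \<delta> \<le> d i"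
  shows "approx_dominated (random_graph_matrix n (embedding_matrix \<alpha> n d)) (random_graph_degrees n d)
    (real (degree_sum n d) * (n * exp (- (\<alpha> ^ 4 * \<delta> / 4))) + exp (- (\<alpha>\<^sup>2 * degree_sum n d / 8)))"
proof -
  let ?F = "graphs_with_degrees n d"
  obtain G0 where G0: "G0 \<in> ?F" using d by (auto simp: degree_sequence_def)
  define m where "m = card G0"
  have card2: "degree_sum n d = 2 * card G" if "G \<in> ?F" for G
    using that handshake[of G n] by (auto simp: graphs_with_degrees_def degree_sum_def)
  have m: "degree_sum n d = 2 * m" using card2[OF G0] by (simp add: m_def)
  then have m0: "0 < m" using \<Delta>(4) by simp
  interpret uniform_family ?F m
  proof
    show "finite ?F" by (rule finite_graphs_with_degrees)
    show "?F \<noteq> {}" using G0 by auto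
    show "card G = m" if "G \<in> ?F" for G using card2[OF that] m by simp
    show "finite G" if "G \<in> ?F" for G using that finite_all_edges finite_subset
      by (auto simp: graphs_with_degrees_def)
  qed
  define w where "w = (\<lambda>e. (1 - 4 * \<alpha>) * (real (d (Min e)) * real (d (Max e)) / (2 * (real m)\<^sup>2)))"
  have w0: "0 \<le> w e" for e using \<alpha> by (simp add: w_def)
  have wsum: "sum w (all_edges n) \<le> 1 - 4 * \<alpha>"
  proof -
    have "real (2 * (\<Sum>e\<in>all_edges n. d (Min e) * d (Max e))) \<le> real ((2 * m)\<^sup>2)"
      using sum_edge_products_le[of d n] unfolding m of_nat_le_iff .
    then have "(\<Sum>e\<in>all_edges n. real (d (Min e)) * real (d (Max e))) \<le> 2 * (real m)\<^sup>2"
      by (simp add: power2_eq_square)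
    then have "(\<Sum>e\<in>all_edges n. real (d (Min e)) * real (d (Max e))) / (2 * (real m)\<^sup>2) \<le> 1"
      using m0 by simp
    then have "(1 - 4 * \<alpha>) * ((\<Sum>e\<in>all_edges n. real (d (Min e)) * real (d (Max e))) / (2 * (real m)\<^sup>2)) \<le> (1 - 4 * \<alpha>) * 1"
      using \<alpha> by (intro mult_left_mono) auto
    then show ?thesis by (simp add: w_def sum_distrib_left sum_divide_distrib)
  qed
  then have wsum1: "sum w (all_edges n) \<le> 1" using \<alpha> by simp
  from ex_one_point_pmf[OF finite_all_edges w0 wsum1] obtain \<kappa> :: "edge_set pmf" where
    \<kappa>: "\<And>e. e \<in> all_edges n \<Longrightarrow> pmf \<kappa> {e} = w e" "pmf \<kappa> {} = 1 - sum w (all_edges n)"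
      "\<And>Y. Y \<in> set_pmf \<kappa> \<Longrightarrow> Y = {} \<or> (\<exists>e\<in>all_edges n. Y = {e})" by blast
  \<comment> \<open>The total weight is at most \<open>1 - 4 * \<alpha>\<close>, so the empty draw
    has positive probability, as the conditioning in the one-point coupling requires.\<close>
  have emp: "{} \<in> set_pmf \<kappa>" using \<kappa>(2) wsum \<alpha> by (simp add: set_pmf_iff)
  define \<beta> where "\<beta> = n * exp (- (\<alpha> ^ 4 * \<delta> / 4))"
  \<comment> \<open>For these numbers of draws a fraction of at least \<alpha> of the edges is still
    unexposed at every step; the Poisson mean chosen below stays \<open>\<alpha> * m\<close> under
    the cap.\<close>
  define I where "I = {N :: nat. real N \<le> (1 - \<alpha>) * m}"
  have dom: "approx_dominated (union_pmf \<kappa> N) (pmf_of_set ?F) (m * \<beta>)" if N: "N \<in> I" for N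
  proof -
    have "0 \<le> \<alpha> * m" using \<alpha> by simp
    then have Nm: "N \<le> m" using N by (simp add: I_def algebra_simps)
    define B where "B = (\<lambda>t. {H. \<exists>i\<in>{1..n}. real (d i - vertex_degree H i) < (1 - \<alpha>) * (real (m - t) / m) * d i})"
    have "approx_dominated (union_pmf \<kappa> N) (pmf_of_set ?F) (real N * \<beta>)"
    proof (rule approx_dominated_uniform[where B = B])
      show "Y = {} \<or> (\<exists>e. Y = {e})" if "Y \<in> set_pmf \<kappa>" for Y using \<kappa>(3)[OF that] by auto
      show "{} \<in> set_pmf \<kappa>" by (rule emp)
      show "N \<le> m" by (rule Nm)
    next
      fix t H e assume t: "t < N" and H: "above H \<noteq> {}" "card H = t" "H \<notin> B t"
      have t': "real t \<le> (1 - \<alpha>) * m" using t N by (simp add: I_def)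
      show "pmf \<kappa> {e} \<le> real (card {G \<in> above H. e \<in> G}) / real (card (above H)) / real (m - t)"
      proof (cases "e \<in> all_edges n")
        case True
        note e = Min_Max_doubleton[OF True]
        have "w e \<le> real (card {G \<in> {G \<in> ?F. H \<subseteq> G}. {Min e, Max e} \<in> G}) /
            real (card {G \<in> ?F. H \<subseteq> G}) / real (m - t)"
          unfolding w_def
          using \<alpha> \<Delta> m m0 H t' e by (intro edge_probability_lower_bound[where \<Delta> = \<Delta>]) (auto simp: above_def B_def not_less)
        then show ?thesis using \<kappa>(1)[OF True] e(1) by (simp add: above_def)
      next
        case False
        then have "pmf \<kappa> {e} = 0" using \<kappa>(3)[of "{e}"] by (auto simp: pmf_eq_0_set_pmf)
        then show ?thesis by simp
      qed
    next
      fix t assume t: "t < N"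
      then have t': "real t \<le> (1 - \<alpha>) * m" using N by (simp add: I_def)
      show "measure_pmf.prob (\<mu> t) (B t) \<le> \<beta>"
        unfolding B_def \<beta>_def using \<alpha> m0 t' \<delta> cardG
        by (intro measure_\<mu>_le random_subset_degree_tail) auto
    qed
    moreover have "real N * \<beta> \<le> m * \<beta>" using Nm by (intro mult_right_mono) (auto simp: \<beta>_def)
    ultimately show ?thesis by (rule approx_dominated_mono)
  qed
  define l where "l = (1 - 2 * \<alpha>) * m"
  have l: "0 < l" using \<alpha> m0 by (simp add: l_def)
  have D: "approx_dominated (bind_pmf (poisson_pmf l) (union_pmf \<kappa>)) (pmf_of_set ?F) (m * \<beta> + measure_pmf.prob (poisson_pmf l) (- I))"
    using dom by (intro approx_dominated_mixture) (auto simp: \<beta>_def)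
  have law: "bind_pmf (poisson_pmf l) (union_pmf \<kappa>) = random_graph_matrix n (embedding_matrix \<alpha> n d)"
  proof (rule poisson_mixture_union_pmf[OF l _ \<kappa>(3)])
    fix e assume e: "e \<in> all_edges n"
    have "Min e \<noteq> Max e" using Min_Max_doubleton(2)[OF e] by simp
    moreover have "(1 - 2 * \<alpha>) * (1 - 4 * \<alpha>) * (real (d (Min e) * d (Max e)) / degree_sum n d) = l * pmf \<kappa> {e}"
      using m0 by (simp add: \<kappa>(1)[OF e] w_def l_def m power2_eq_square)
    ultimately show "embedding_matrix \<alpha> n d (Min e) (Max e) = 1 - exp (- (l * pmf \<kappa> {e}))" by (simp add: embedding_matrix_def)
  qed
  have "m * \<beta> + measure_pmf.prob (poisson_pmf l) (- I) \<le>
      real (degree_sum n d) * (n * exp (- (\<alpha> ^ 4 * \<delta> / 4))) + exp (- (\<alpha>\<^sup>2 * degree_sum n d / 8))"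
  proof (rule add_mono)
    show "m * \<beta> \<le> real (degree_sum n d) * (n * exp (- (\<alpha> ^ 4 * \<delta> / 4)))"
      unfolding \<beta>_def by (intro mult_right_mono) (auto simp: m)
    have "measure_pmf.prob (poisson_pmf l) (- I) \<le> measure_pmf.prob (poisson_pmf l) {k. (1 - \<alpha>) * m \<le> real k}"
      by (intro measure_pmf.finite_measure_mono) (auto simp: I_def)
    also have "\<dots> \<le> exp (l * ((1 + \<alpha> / 2) - 1)) * (1 + \<alpha> / 2) powr (- ((1 - \<alpha>) * m))"
      using l \<alpha> by (intro poisson_upper_tail) auto
    also have "\<dots> \<le> exp (- (\<alpha>\<^sup>2 * m / 4))"
      unfolding l_def using \<alpha> by (intro poisson_exponent_bound) auto
    finally show "measure_pmf.prob (poisson_pmf l) (- I) \<le> exp (- (\<alpha>\<^sup>2 * degree_sum n d / 8))"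
      by (simp add: m mult.commute)
  qed
  with D show ?thesis unfolding random_graph_degrees_def law by (rule approx_dominated_mono)
qed

section \<open>Asymptotics\<close>

text \<open>A single \<open>\<eta>\<close> bounds both the relative error of the matrix and the
  failure probability. The property is then monotone in \<open>\<eta>\<close> and holds for
  \<open>\<eta> = 1\<close>, as the diagonal argument requires.\<close>

definition embeds :: "nat \<Rightarrow> (nat \<Rightarrow> nat) \<Rightarrow> real \<Rightarrow> bool" where
  "embeds n d \<eta> \<longleftrightarrow> (\<exists>W. (\<forall>j\<in>{1..n}. \<forall>k\<in>{1..n}. 0 \<le> W j k \<and> W j k \<le> 1 \<and> W j k = W k j \<and>
      (1 - \<eta>) * degree_matrix n d j k \<le> W j k \<and> W j k \<le> degree_matrix n d j k) \<and>
    approx_dominated (random_graph_matrix n W) (random_graph_degrees n d) \<eta>)"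

lemma degree_matrix_nonneg: "0 \<le> degree_matrix n d j k"
  by (simp add: degree_matrix_def)

lemma embeds_mono: "embeds n d \<eta> \<Longrightarrow> \<eta> \<le> \<eta>' \<Longrightarrow> embeds n d \<eta>'"
proof -
  assume "embeds n d \<eta>" and le: "\<eta> \<le> \<eta>'"
  then obtain W where W: "\<forall>j\<in>{1..n}. \<forall>k\<in>{1..n}. 0 \<le> W j k \<and> W j k \<le> 1 \<and> W j k = W k j \<and>
      (1 - \<eta>) * degree_matrix n d j k \<le> W j k \<and> W j k \<le> degree_matrix n d j k"
    "approx_dominated (random_graph_matrix n W) (random_graph_degrees n d) \<eta>" unfolding embeds_def by blast
  have "(1 - \<eta>') * degree_matrix n d j k \<le> (1 - \<eta>) * degree_matrix n d j k" for j k
    using le degree_matrix_nonneg by (intro mult_right_mono) auto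
  then show ?thesis
    unfolding embeds_def using W approx_dominated_mono[OF W(2) le]
    by (intro exI[of _ W]) (meson order_trans)
qed

text \<open>For \<open>\<eta> = 1\<close> the lower bound on the matrix becomes 0, so the zero
  matrix qualifies. This serves the small \<open>n\<close>, about which the asymptotic hypotheses
  say nothing.\<close>

lemma embeds_1: "embeds n d 1"
  unfolding embeds_def
  by (intro exI[of _ "\<lambda>_ _. 0"]) (simp add: approx_dominated_trivial degree_matrix_nonneg)

lemma embeds_explicit:
  fixes \<alpha> \<delta> :: real
  assumes \<alpha>: "0 < \<alpha>" "\<alpha> \<le> 1 / 8" and d: "degree_sequence n d"
    and \<Delta>: "\<And>i. i \<in> {1..n} \<Longrightarrow> d i \<le> \<Delta>" "4 * (real \<Delta>)\<^sup>2 \<le> \<alpha>\<^sup>2 * degree_sum n d" "1 \<le> \<Delta>" "0 < degree_sum n d"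
    and \<delta>: "\<And>i. i \<in> {1..n} \<Longrightarrow> \<delta> \<le> d i"
    and le: "real (degree_sum n d) * (n * exp (- (\<alpha> ^ 4 * \<delta> / 4))) + exp (- (\<alpha>\<^sup>2 * degree_sum n d / 8)) \<le> 7 * \<alpha>"
  shows "embeds n d (7 * \<alpha>)"
proof -
  have "embedding_matrix \<alpha> n d j k = embedding_matrix \<alpha> n d k j" for j k by (simp add: embedding_matrix_def mult.commute)
  then show ?thesis unfolding embeds_def
    using embedding_matrix_bounds[OF \<alpha> _ _ \<Delta>(1,2,4)] approx_dominated_mono[OF approx_dominated_random_graph[OF \<alpha> d \<Delta> \<delta>] le]
    by (intro exI[of _ "embedding_matrix \<alpha> n d"]) blast
qed

lemma degree_bounds:
  assumes "i \<in> {1..n}"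
  shows "d i \<le> max_degree n d" "min_degree n d \<le> d i"
  using assms by (auto simp: max_degree_def min_degree_def)

text \<open>For fixed \<alpha> the minimum degree eventually exceeds
  \<open>16 * ln n / \<alpha> ^ 4\<close>. The factor 16 makes the failure probability of one
  residual degree at most n^(-4), which beats the n^3 choices of an exposure step and a vertex and
  leaves 1 / n.\<close>

lemma eventually_embeds:
  fixes d :: "nat \<Rightarrow> nat \<Rightarrow> nat"
  assumes d: "\<And>n. degree_sequence n (d n)"
    and max: "(\<lambda>n. (real (max_degree n (d n)))\<^sup>2) \<in> o(\<lambda>n. real (degree_sum n (d n)))"
    and min: "(\<lambda>n. ln (real n)) \<in> o(\<lambda>n. real (min_degree n (d n)))"
    and \<epsilon>: "0 < \<epsilon>"
  shows "eventually (\<lambda>n. embeds n (d n) \<epsilon>) sequentially"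
proof -
  define \<alpha> where "\<alpha> = min (1 / 8) (\<epsilon> / 7)"
  have \<alpha>: "0 < \<alpha>" "\<alpha> \<le> 1 / 8" "7 * \<alpha> \<le> \<epsilon>" using \<epsilon> by (auto simp: \<alpha>_def min_def)
  have e1: "eventually (\<lambda>n. (real (max_degree n (d n)))\<^sup>2 \<le> \<alpha>\<^sup>2 / 4 * real (degree_sum n (d n))) sequentially"
    using landau_o.smallD[OF max, of "\<alpha>\<^sup>2 / 4"] \<alpha> by simp
  have e2: "eventually (\<lambda>n. \<bar>ln (real n)\<bar> \<le> \<alpha> ^ 4 / 16 * real (min_degree n (d n))) sequentially"
    using landau_o.smallD[OF min, of "\<alpha> ^ 4 / 16"] \<alpha> by simp
  have e3: "eventually (\<lambda>n. inverse (real n) + exp (- (\<alpha>\<^sup>2 * real n / 8)) \<le> 7 * \<alpha>) sequentially"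
  proof -
    have "((\<lambda>n. inverse (real n) + exp (- (\<alpha>\<^sup>2 * real n / 8))) \<longlongrightarrow> 0) sequentially"
    proof -
      have "(\<lambda>n. exp (- (\<alpha>\<^sup>2 / 8)) ^ n) \<longlonglongrightarrow> 0"
        using \<alpha> by (intro LIMSEQ_realpow_zero) auto
      moreover have "exp (- (\<alpha>\<^sup>2 / 8)) ^ n = exp (- (\<alpha>\<^sup>2 * real n / 8))" for n
        by (simp add: exp_of_nat_mult[symmetric] mult.commute)
      ultimately have "(\<lambda>n. exp (- (\<alpha>\<^sup>2 * real n / 8))) \<longlonglongrightarrow> 0" by simp
      then show ?thesis using tendsto_add[OF lim_inverse_n] by fastforce
    qed
    then have "eventually (\<lambda>n. inverse (real n) + exp (- (\<alpha>\<^sup>2 * real n / 8)) < 7 * \<alpha>) sequentially"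
      using \<alpha> by (intro order_tendstoD) auto
    then show ?thesis by eventually_elim simp
  qed
  \<comment> \<open>For \<open>n \<ge> 2\<close> the logarithm is positive, which forces a positive
    minimum degree and thereby \<open>\<Delta> \<ge> 1\<close> and \<open>n \<le> S\<close>.\<close>
  from e1 e2 e3 eventually_ge_at_top[of 2] show ?thesis
  proof eventually_elim
    case (elim n)
    define \<Delta> where "\<Delta> = max_degree n (d n)"
    define \<delta> where "\<delta> = min_degree n (d n)"
    define S where "S = degree_sum n (d n)"
    have b: "d n i \<le> \<Delta>" "\<delta> \<le> d n i" if "i \<in> {1..n}" for i
      using degree_bounds[OF that, of "d n"] by (auto simp: \<Delta>_def \<delta>_def)
    have ln: "0 < ln (real n)" using elim by simp
    then have \<delta>ln: "16 * ln (real n) \<le> \<alpha> ^ 4 * \<delta>" using elim by (simp add: \<delta>_def)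
    have "0 < \<alpha> ^ 4 * \<delta>" using \<delta>ln ln by linarith
    then have \<delta>1: "1 \<le> \<delta>" by (cases \<delta>) auto
    have "1 \<in> {1..n}" using elim by simp
    then have \<Delta>1: "1 \<le> \<Delta>" using b \<delta>1 by (meson order_trans)
    have nS: "n \<le> S"
    proof -
      have "(\<Sum>i\<in>{1..n}. 1) \<le> S" unfolding S_def degree_sum_def
        using b \<delta>1 by (intro sum_mono) (meson order_trans)
      then show ?thesis by simp
    qed
    have \<Delta>2: "4 * (real \<Delta>)\<^sup>2 \<le> \<alpha>\<^sup>2 * S" using elim by (simp add: \<Delta>_def S_def)
    have "S \<le> n * \<Delta>" unfolding S_def degree_sum_def
      using sum_bounded_above[of "{1..n}" "d n" \<Delta>] b by simp
    \<comment> \<open>Combined with \<open>S \<le> n * \<Delta>\<close> this gives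
      \<open>\<Delta> \<le> n\<close>, and so a polynomial bound on the number of exposure
      steps.\<close>
    moreover have "\<Delta> * \<Delta> \<le> S"
    proof -
      have "\<alpha>\<^sup>2 \<le> 1" using \<alpha> by (simp add: power_le_one)
      then have "\<alpha>\<^sup>2 * S \<le> 1 * real S" by (intro mult_right_mono) auto
      then have "real \<Delta> * real \<Delta> \<le> real S"
        using \<Delta>2 zero_le_square[of "real \<Delta>"] unfolding power2_eq_square by linarith
      then show ?thesis by (metis of_nat_le_iff of_nat_mult)
    qed
    ultimately have "\<Delta> * \<Delta> \<le> n * \<Delta>" by linarith
    then have "\<Delta> \<le> n" using \<Delta>1 by simp
    then have Sn: "S \<le> n * n" using \<open>S \<le> n * \<Delta>\<close> by (meson mult_le_mono2 order_trans)
    have "embeds n (d n) (7 * \<alpha>)"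
    proof (rule embeds_explicit[OF \<alpha>(1,2) d, where \<Delta> = \<Delta> and \<delta> = \<delta>])
      have "exp (- (\<alpha> ^ 4 * \<delta> / 4)) \<le> exp (- (4 * ln (real n)))" using \<delta>ln by simp
      also have "\<dots> = inverse (real n) ^ 4"
        using elim exp_of_nat_mult[of 4 "- ln (real n)"] by (simp add: exp_minus)
      finally have "real S * (n * exp (- (\<alpha> ^ 4 * \<delta> / 4))) \<le> real (n * n) * (n * inverse (real n) ^ 4)"
        using Sn by (intro mult_mono) (auto simp del: of_nat_mult)
      also have "\<dots> = inverse (real n)" using elim by (simp add: field_simps power4_eq_xxxx)
      finally have 1: "real S * (n * exp (- (\<alpha> ^ 4 * \<delta> / 4))) \<le> inverse (real n)" .
      have "\<alpha>\<^sup>2 * real n \<le> \<alpha>\<^sup>2 * S" using nS by (intro mult_left_mono) auto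
      then have "exp (- (\<alpha>\<^sup>2 * S / 8)) \<le> exp (- (\<alpha>\<^sup>2 * real n / 8))" by simp
      with 1 elim(3) show "real (degree_sum n (d n)) * (n * exp (- (\<alpha> ^ 4 * real \<delta> / 4))) +
          exp (- (\<alpha>\<^sup>2 * degree_sum n (d n) / 8)) \<le> 7 * \<alpha>"
        unfolding S_def by linarith
    qed (use b \<Delta>1 \<Delta>2 nS elim in \<open>auto simp: S_def\<close>)
    then show ?case using \<alpha>(3) by (rule embeds_mono)
  qed
qed

text \<open>The sequence is the infimum of the precisions valid at \<open>n\<close>, which tends to
  0 by \<open>ev\<close>, plus a positive null sequence, since the infimum need not be attained.
  \<open>one\<close> keeps the set of valid precisions nonempty at every \<open>n\<close>.\<close>

lemma diagonal_sequence:
  fixes P :: "nat \<Rightarrow> real \<Rightarrow> bool"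
  assumes ev: "\<And>\<epsilon>. 0 < \<epsilon> \<Longrightarrow> eventually (\<lambda>n. P n \<epsilon>) sequentially"
    and mono: "\<And>n \<epsilon> \<epsilon>'. P n \<epsilon> \<Longrightarrow> \<epsilon> \<le> \<epsilon>' \<Longrightarrow> P n \<epsilon>'" and one: "\<And>n. P n 1"
  shows "\<exists>\<eta>. \<eta> \<longlonglongrightarrow> 0 \<and> (\<forall>n. 0 \<le> \<eta> n \<and> P n (\<eta> n))"
proof -
  define I where "I = (\<lambda>n. Inf {\<epsilon>. 0 \<le> \<epsilon> \<and> P n \<epsilon>})"
  define \<eta> where "\<eta> = (\<lambda>n. I n + inverse (real (Suc n)))"
  have bdd: "bdd_below {\<epsilon>. 0 \<le> \<epsilon> \<and> P n \<epsilon>}" for n by (intro bdd_belowI[of _ 0]) auto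
  have ne: "{\<epsilon>. 0 \<le> \<epsilon> \<and> P n \<epsilon>} \<noteq> {}" for n using one[of n] by (auto intro: exI[of _ 1])
  have I0: "0 \<le> I n" for n unfolding I_def using ne by (intro cInf_greatest) auto
  have "P n (\<eta> n)" for n
  proof -
    have "Inf {\<epsilon>. 0 \<le> \<epsilon> \<and> P n \<epsilon>} < \<eta> n" by (simp add: \<eta>_def I_def)
    then obtain \<epsilon> where "P n \<epsilon>" "\<epsilon> < \<eta> n" using cInf_less_iff[OF ne bdd] by blast
    then show ?thesis using mono by fastforce
  qed
  moreover have "\<eta> \<longlonglongrightarrow> 0"
  proof -
    have "I \<longlonglongrightarrow> 0"
    proof (rule LIMSEQ_I)
      fix r :: real assume r: "0 < r"
      have "eventually (\<lambda>n. P n (r / 2)) sequentially" using r by (intro ev) simp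
      then obtain N where N: "\<And>n. n \<ge> N \<Longrightarrow> P n (r / 2)" unfolding eventually_sequentially by blast
      have "norm (I n - 0) < r" if "n \<ge> N" for n
      proof -
        have "I n \<le> r / 2" unfolding I_def using N[OF that] r by (intro cInf_lower bdd) auto
        then show ?thesis using I0[of n] r by simp
      qed
      then show "\<exists>N. \<forall>n\<ge>N. norm (I n - 0) < r" by blast
    qed
    then show ?thesis unfolding \<eta>_def using LIMSEQ_inverse_real_of_nat tendsto_add by force
  qed
  moreover have "0 \<le> \<eta> n" for n using I0[of n] by (simp add: \<eta>_def)
  ultimately show ?thesis by blast
qed

lemma coupling_measure_pmf: "coupling (measure_pmf \<pi>) fst snd (map_pmf fst \<pi>) (map_pmf snd \<pi>)"
  unfolding coupling_def by (simp add: map_pmf_rep_eq measure_pmf.prob_space_axioms)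

theorem theorem2:
  fixes d :: "nat \<Rightarrow> nat \<Rightarrow> nat"
  assumes "\<And>n. degree_sequence n (d n)"
    and "(\<lambda>n. (real (max_degree n (d n)))\<^sup>2) \<in> o(\<lambda>n. real (degree_sum n (d n)))"
    and "(\<lambda>n. ln (real n)) \<in> o(\<lambda>n. real (min_degree n (d n)))"
  shows "\<exists>W :: nat \<Rightarrow> nat \<Rightarrow> nat \<Rightarrow> real.
    (\<forall>n. \<forall>j\<in>{1..n}. \<forall>k\<in>{1..n}. W n j k \<in> {0..1} \<and> W n j k = W n k j) \<and>
    (\<exists>(\<epsilon> :: nat \<Rightarrow> nat \<Rightarrow> nat \<Rightarrow> real) (\<eta> :: nat \<Rightarrow> real).
       \<eta> \<longlonglongrightarrow> 0 \<and>
       (\<forall>n. \<forall>j\<in>{1..n}. \<forall>k\<in>{1..n}.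
          \<bar>\<epsilon> n j k\<bar> \<le> \<eta> n \<and> W n j k = (1 - \<epsilon> n j k) * degree_matrix n (d n) j k)) \<and>
    (\<exists>(M :: nat \<Rightarrow> (edge_set \<times> edge_set) measure) GL G.
       (\<forall>n. coupling (M n) (GL n) (G n)
              (random_graph_matrix n (W n)) (random_graph_degrees n (d n))) \<and>
       (\<lambda>n. measure (M n) {\<omega> \<in> space (M n). GL n \<omega> \<subseteq> G n \<omega>}) \<longlonglongrightarrow> 1)"
proof -
  let ?P = "\<lambda>n. degree_matrix n (d n)"
  obtain \<eta> where \<eta>: "\<eta> \<longlonglongrightarrow> 0" "\<And>n. 0 \<le> \<eta> n" "\<And>n. embeds n (d n) (\<eta> n)"
    using diagonal_sequence[of "\<lambda>n. embeds n (d n)"] eventually_embeds[OF assms] embeds_mono embeds_1 by blast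
  from \<eta>(3) obtain W where W: "\<And>n j k. j \<in> {1..n} \<Longrightarrow> k \<in> {1..n} \<Longrightarrow> 0 \<le> W n j k \<and> W n j k \<le> 1 \<and> W n j k = W n k j \<and>
      (1 - \<eta> n) * ?P n j k \<le> W n j k \<and> W n j k \<le> ?P n j k"
    and dom: "\<And>n. approx_dominated (random_graph_matrix n (W n)) (random_graph_degrees n (d n)) (\<eta> n)"
    unfolding embeds_def by metis
  from dom obtain \<pi> where \<pi>: "\<And>n. map_pmf fst (\<pi> n) = random_graph_matrix n (W n)"
    "\<And>n. map_pmf snd (\<pi> n) = random_graph_degrees n (d n)"
    "\<And>n. measure_pmf.prob (\<pi> n) {(L, H). \<not> L \<subseteq> H} \<le> \<eta> n"
    unfolding approx_dominated_def by metis
  \<comment> \<open>Where the entry of \<open>?P\<close> is 0, as on the diagonal, \<open>W\<close>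
    is squeezed to 0 as well; the relative error 0 is chosen there because the quotient carries no
    information.\<close>
  define \<epsilon> where "\<epsilon> n j k = (if ?P n j k = 0 then 0 else 1 - W n j k / ?P n j k)" for n j k
  show ?thesis
  proof (rule exI[of _ W], intro conjI)
    show "\<forall>n. \<forall>j\<in>{1..n}. \<forall>k\<in>{1..n}. W n j k \<in> {0..1} \<and> W n j k = W n k j"
      using W by simp
    show "\<exists>(\<epsilon> :: nat \<Rightarrow> nat \<Rightarrow> nat \<Rightarrow> real) (\<eta> :: nat \<Rightarrow> real). \<eta> \<longlonglongrightarrow> 0 \<and> (\<forall>n. \<forall>j\<in>{1..n}. \<forall>k\<in>{1..n}.
          \<bar>\<epsilon> n j k\<bar> \<le> \<eta> n \<and> W n j k = (1 - \<epsilon> n j k) * ?P n j k)"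
    proof (intro exI[of _ \<epsilon>] exI[of _ \<eta>] conjI allI ballI)
      fix n j k :: nat assume jk: "j \<in> {1..n}" "k \<in> {1..n}"
      show "\<bar>\<epsilon> n j k\<bar> \<le> \<eta> n"
      proof (cases "?P n j k = 0")
        case False
        then have P: "0 < ?P n j k" using degree_matrix_nonneg[of n "d n" j k] by simp
        have "W n j k / ?P n j k \<le> 1" "1 - \<eta> n \<le> W n j k / ?P n j k"
          using W[OF jk] P by (simp_all add: field_simps)
        then show ?thesis using P by (simp add: \<epsilon>_def)
      qed (use \<eta> in \<open>simp add: \<epsilon>_def\<close>)
      show "W n j k = (1 - \<epsilon> n j k) * ?P n j k"
        using W[OF jk] by (auto simp: \<epsilon>_def)
    qed (rule \<eta>)
    show "\<exists>(M :: nat \<Rightarrow> (edge_set \<times> edge_set) measure) GL G.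
       (\<forall>n. coupling (M n) (GL n) (G n) (random_graph_matrix n (W n)) (random_graph_degrees n (d n))) \<and>
       (\<lambda>n. measure (M n) {\<omega> \<in> space (M n). GL n \<omega> \<subseteq> G n \<omega>}) \<longlonglongrightarrow> 1"
    proof (rule exI[of _ "\<lambda>n. measure_pmf (\<pi> n)"], rule exI[of _ "\<lambda>_. fst"], rule exI[of _ "\<lambda>_. snd"], intro conjI allI)
      show "coupling (measure_pmf (\<pi> n)) fst snd (random_graph_matrix n (W n)) (random_graph_degrees n (d n))" for n
        using coupling_measure_pmf[of "\<pi> n"] by (simp add: \<pi>)
      have ge: "1 - \<eta> n \<le> measure (\<pi> n) {\<omega> \<in> space (\<pi> n). fst \<omega> \<subseteq> snd \<omega>}" for n
      proof -
        have eq: "{\<omega> \<in> space (measure_pmf (\<pi> n)). fst \<omega> \<subseteq> snd \<omega>} = space (measure_pmf (\<pi> n)) - {(L, H). \<not> L \<subseteq> H}"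
          by auto
        show ?thesis unfolding eq using \<pi>(3)[of n] by (subst measure_pmf.prob_compl) auto
      qed
      have lim: "(\<lambda>n. 1 - \<eta> n) \<longlonglongrightarrow> 1" using tendsto_diff[OF tendsto_const \<eta>(1), of 1] by simp
      show "(\<lambda>n. measure (\<pi> n) {\<omega> \<in> space (\<pi> n). fst \<omega> \<subseteq> snd \<omega>}) \<longlonglongrightarrow> 1"
        by (rule tendsto_sandwich[OF _ _ lim tendsto_const[of 1]]) (auto simp: ge simp del: space_measure_pmf)
    qed
  qed
qed

end
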